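(* Let $a\neq 0$ be a real number, let $F$ be a nonempty finite set of positive integers, let $k$ be the number of elements of $F$ and $f_k=\max F$. Let $G=I(F)=\{g_1,\ldots,g_m\}$ with $g_i<g_{i+1}$, where $I(F)=\{1,2,\ldots,f_k\}\setminus\{f_k-f : f\in F\}$. Let $\rho_a$ be the Charlier measure and $(c_n^a)_n$ the Charlier polynomials. Assume that $\Omega_G(n)\neq 0$ for all integers $n\ge 0$, where $$\Omega_G(n)=\det\left(c^{-a}_{g_l}(-n+j-1)\right)_{l,j=1}^m .$$ Define the sequence of polynomials $(q_n)_{n\ge 0}$ by $$q_n(x)=\begin{vmatrix} c^a_n(x) & -c^a_{n-1}(x) & \cdots & (-1)^m c^a_{n-m}(x)\\ c^{-a}_{g_1}(-n-1) & c^{-a}_{g_1}(-n) & \cdots & c^{-a}_{g_1}(-n+m-1)\\ \vdots & \vdots & \ddots & \vdots\\ c^{-a}_{g_m}(-n-1) & c^{-a}_{g_m}(-n) & \cdots & c^{-a}_{g_m}(-n+m-1)\end{vmatrix}.$$ Then: (1) The polynomials $(q_n)_n$ are orthogonal with respect to the measure $$\tilde\rho_a^F=\prod_{f\in F}(x+f_k+1-f)\,\rho_a(x+f_k+1).$$ (2) The polynomials $(q_n)_n$ are eigenfunctions of a higher order difference operator of the form $D=\sum_{l=-r}^{r}h_l\,\mathfrak{s}_l$, with $h_l$ polynomials and $h_{-r},h_r\neq 0$, where $$r=\sum_{f\in F}f-\frac{k(k-1)}{2}+1;$$ that is, for every $n\ge 0$ there is a number $\lambda_n$ with $D(q_n)=\lambda_n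 q_n$.
   Context: Charlier polynomials: for $a\ne 0$ and $n\ge 0$, $c_n^a(x)=\frac{1}{n!}\sum_{j=0}^n(-a)^{n-j}\binom{n}{j}\binom{x}{j}j!$, and $c_n^a=0$ for $n<0$. Here $\binom{x}{j}=x(x-1)\cdots(x-j+1)/j!$. Charlier measure: $\rho_a=\sum_{x=0}^\infty\frac{a^x}{x!}\delta_x$ (possibly signed). For a measure (or moment functional) $\mu$ and a real $\lambda$, $\mu(x+\lambda)$ is defined by $\langle\mu(x+\lambda),p\rangle=\langle\mu,p(x-\lambda)\rangle$ for polynomials $p$. For a polynomial $s$, the product $s\mu$ is defined by $\langle s\mu,p\rangle=\langle\mu,sp\rangle$. A sequence $(q_n)_{n\ge0}$ of polynomials with $\deg q_n=n$ is orthogonal with respect to $\mu$ if $\langle\mu,q_nq_k\rangle=0$ for $n\neq k$ and $\langle\mu,q_n^2\rangle\neq 0$ for all $n$. Shift operators: $\mathfrak{s}_l(p)(x)=p(x+l)$. A difference operator $\sum_{l=s}^r h_l\mathfrak{s}_l$ with polynomial coefficients and $h_s,h_r\neq0$ has order $r-s$. *)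

theory Defs
  imports Complex_Main "Jordan_Normal_Form.Determinant"
begin

definition binom_poly :: "nat \<Rightarrow> real poly" where
  "binom_poly j = smult (1 / fact j) (\<Prod>i<j. [:- real i, 1:])"

lemma poly_binom_poly: "poly (binom_poly j) x = x gchoose j"
  by (simp add: binom_poly_def gbinomial_prod_rev poly_prod lessThan_atLeast0)

text \<open>The index is an integer because the determinants below use \<open>c\<^sub>n = 0\<close> for \<open>n < 0\<close>.\<close>

definition charlier :: "real \<Rightarrow> int \<Rightarrow> real poly" where
  "charlier a n =
     (if n < 0 then 0
      else smult (1 / fact (nat n))
        (\<Sum>j\<le>nat n. smult ((- a) ^ (nat n - j) * real (nat n choose j) * fact j) (binom_poly j)))"

text \<open>
  A possibly signed measure with finite moments is represented by its moment functional
  \<open>p \<mapsto> \<langle>\<mu>, p\<rangle>\<close> on polynomials.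
\<close>

type_synonym moment_functional = "real poly \<Rightarrow> real"

definition charlier_measure :: "real \<Rightarrow> moment_functional" where
  "charlier_measure a p = (\<Sum>x. a ^ x / fact x * poly p (real x))"

lemma summable_charlier_measure: "summable (\<lambda>x. a ^ x / fact x * poly p (real x))"
proof (induction "degree p" arbitrary: p rule: less_induct)
  case less
  show ?case
  proof (cases "degree p = 0")
    case True
    then obtain c where "p = [:c:]" by (rule degree_eq_zeroE)
    then show ?thesis
      using summable_mult2[OF summable_exp[of a], of c] by (simp add: field_simps)
  next
    case False
    obtain c p' where p: "p = pCons c p'" by (cases p)
    with False have "degree (pcompose p' [:1, 1:]) < degree p"
      by (auto simp: degree_pcompose split: if_splits)
    from less[OF this]
    have "summable (\<lambda>x. a * (a ^ x / fact x * poly p' (real x + 1)))"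
      by (intro summable_mult) (simp add: poly_pcompose add.commute)
    also have "(\<lambda>x. a * (a ^ x / fact x * poly p' (real x + 1))) =
        (\<lambda>x. a ^ Suc x / fact (Suc x) * (real (Suc x) * poly p' (real (Suc x))))"
      by (rule ext) (simp add: divide_simps del: of_nat_Suc, simp add: add.commute)
    finally have "summable (\<lambda>x. a ^ x / fact x * (real x * poly p' (real x)))"
      by (subst (asm) summable_Suc_iff)
    moreover have "summable (\<lambda>x. a ^ x / fact x * c)"
      using summable_mult2[OF summable_exp[of a], of c] by (simp add: field_simps)
    ultimately have "summable (\<lambda>x. a ^ x / fact x * c + a ^ x / fact x * (real x * poly p' (real x)))"
      by (rule summable_add[rotated])
    then show ?thesis by (simp add: p distrib_left)
  qed
qed

definition shift_poly :: "real \<Rightarrow> real poly \<Rightarrow> real poly" where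
  "shift_poly l p = pcompose p [:l, 1:]"

lemma poly_shift_poly: "poly (shift_poly l p) x = poly p (x + l)"
  by (simp add: shift_poly_def poly_pcompose add.commute)

text \<open>The functional \<open>\<mu>(x + l)\<close>: \<open>\<langle>\<mu>(x + l), p\<rangle> = \<langle>\<mu>, p(x - l)\<rangle>\<close>.\<close>

definition shift_measure :: "real \<Rightarrow> moment_functional \<Rightarrow> moment_functional" where
  "shift_measure l \<mu> p = \<mu> (shift_poly (- l) p)"

definition times_measure :: "real poly \<Rightarrow> moment_functional \<Rightarrow> moment_functional" where
  "times_measure s \<mu> p = \<mu> (s * p)"

definition orthogonal_polys :: "moment_functional \<Rightarrow> (nat \<Rightarrow> real poly) \<Rightarrow> bool" where
  "orthogonal_polys \<mu> q \<longleftrightarrow>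
     (\<forall>n. degree (q n) = n) \<and>
     (\<forall>n k. n \<noteq> k \<longrightarrow> \<mu> (q n * q k) = 0) \<and>
     (\<forall>n. \<mu> (q n ^ 2) \<noteq> 0)"

text \<open>
  \<open>\<Sum>\<^bsub>l=s..r\<^esub> h\<^sub>l \<s>\<^sub>l\<close>, where the shift operator \<open>\<s>\<^sub>l\<close> is \<^term>\<open>shift_poly (of_int l)\<close>.
\<close>

definition diff_operator :: "int \<Rightarrow> int \<Rightarrow> (int \<Rightarrow> real poly) \<Rightarrow> real poly \<Rightarrow> real poly" where
  "diff_operator s r h p = (\<Sum>l=s..r. h l * shift_poly (of_int l) p)"

definition invol :: "nat set \<Rightarrow> nat set" where
  "invol F = {1..Max F} - {Max F - f | f. f \<in> F}"

text \<open>\<open>tilde_measure a F\<close> is \<open>\<Prod>\<^bsub>f\<in>F\<^esub> (x + f\<^sub>k + 1 - f) \<rho>\<^sub>a(x + f\<^sub>k + 1)\<close> with \<open>f\<^sub>k = max F\<close>.\<close>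

definition tilde_measure :: "real \<Rightarrow> nat set \<Rightarrow> moment_functional" where
  "tilde_measure a F =
     times_measure (\<Prod>f\<in>F. [:real (Max F) + 1 - real f, 1:])
       (shift_measure (real (Max F) + 1) (charlier_measure a))"

text \<open>
  In the following two determinants rows and columns are counted from 0, and
  \<open>sorted_list_of_set G ! i\<close> is \<open>g\<^bsub>i+1\<^esub>\<close>, where \<open>G = {g\<^sub>1 < \<dots> < g\<^sub>m}\<close>.
\<close>

definition Omega :: "real \<Rightarrow> nat set \<Rightarrow> nat \<Rightarrow> real" where
  "Omega a G n =
     det (mat (card G) (card G) (\<lambda>(i, j).
       poly (charlier (- a) (int (sorted_list_of_set G ! i))) (- real n + real j)))"

definition q_poly :: "real \<Rightarrow> nat set \<Rightarrow> nat \<Rightarrow> real poly" where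
  "q_poly a G n =
     det (mat (card G + 1) (card G + 1) (\<lambda>(i, j).
       if i = 0 then (- 1) ^ j * charlier a (int n - int j)
       else [:poly (charlier (- a) (int (sorted_list_of_set G ! (i - 1))))
                (- real n - 1 + real j):]))"

end

theory Submission
  imports Defs
begin

text \<open>
  Expanding the determinant along its first row gives \<open>q\<^sub>n = \<Sum>\<^sub>j (-1)\<^bsup>j\<^esup> \<beta>\<^sub>j(n) c\<^bsub>n - j\<^esub>\<close>, where the cofactors \<open>\<beta>\<^sub>j\<close> are
  polynomials in \<open>n\<close> with \<open>\<Sum>\<^sub>j \<beta>\<^sub>j(n) y\<^sub>g(n - j) = 0\<close> for each of the functions \<open>y\<^sub>g(n) = c\<^sub>g(- n - 1)\<close> with parameter
  \<open>- a\<close>, \<open>g \<in> G\<close>.  Moreover \<open>\<beta>\<^sub>0(n) = \<Omega>\<^sub>G(n)\<close> and \<open>\<beta>\<^sub>m(n) = \<plusminus> \<Omega>\<^sub>G(n + 1)\<close>.  Both parts rest on this annihilation property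
  (\<open>border_cof_annihilates\<close>).

  Orthogonality.  With \<open>N = max F + 1\<close>, the set \<open>F\<close> and the numbers \<open>N - 1 - g\<close>, \<open>g \<in> G\<close>, partition \<open>{0, \<dots>, N - 1}\<close>.
  Hence the functional \<open>\<mu>\<close> of the theorem becomes a multiple of the Charlier functional after multiplication
  with \<open>\<Prod>\<^bsub>g \<in> G\<^esub> (x + g + 1)\<close> (\<open>tilde_measure_node_poly\<close>).  So, for \<open>p\<close> of small degree, \<open>\<langle>\<mu>, p c\<^sub>i\<rangle>\<close> depends only on the values of
  \<open>p\<close> at the nodes \<open>- g - 1\<close>, and by Lagrange interpolation and \<open>charlier_measure_dual\<close> it is
  \<open>(-1)\<^bsup>i\<^esup> \<Sum>\<^sub>g w\<^sub>g(p) y\<^sub>g(i)\<close> with weights that are independent of \<open>i\<close>.  For \<open>i < 0\<close>, where \<open>c\<^sub>i = 0\<close>, the same formula holds since the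
  sum is a divided difference of a polynomial of small degree, by the duality between degree and argument of
  the Charlier polynomials.  In \<open>\<langle>\<mu>, p q\<^sub>n\<rangle>\<close> with \<open>degree p < n\<close> all degrees are small enough, and the annihilation property
  gives 0.  If \<open>degree p = n\<close>, the formula fails only for the last index \<open>j = m\<close>, and \<open>\<langle>\<mu>, p q\<^sub>n\<rangle>\<close> is \<open>\<Omega>\<^sub>G(n + 1)\<close> times a nonzero
  number (\<open>tilde_q_poly\<close>).

  The difference operator.  Let \<open>H\<close> be the second order operator with \<open>H c\<^sub>n = n c\<^sub>n\<close>.  Choose a polynomial \<open>P\<close> with
  \<open>P(x) - P(x - 1) = \<Omega>\<^sub>G(x)\<close>.  The operator \<open>D = P(H) + \<Sum>\<^sub>g M\<^sub>g(H) \<nabla> y\<^sub>g(H)\<close> satisfies \<open>D q\<^sub>n = P(n) q\<^sub>n\<close>, if the polynomials \<open>M\<^sub>g\<close> are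
  suitable sums of cofactors of the Casorati matrix \<open>(y\<^sub>g(n - r))\<close>; this is an instance of the orthogonality
  between columns and cofactors (\<open>cofactor_sum_identity\<close>, \<open>eigen_op_bordered_charlier\<close>).

  The order of \<open>D\<close> is hard to read off from its formula, because extreme coefficients of the summands cancel.
  But \<open>q\<^sub>n = B c\<^sub>n\<close> for the difference operator \<open>B = \<Sum>\<^sub>j (-1)\<^bsup>j\<^esup> \<Delta>\<^bsup>j\<^esup> \<beta>\<^sub>j(H)\<close>, and the eigenvalue equation says \<open>D B = B P(H)\<close>.  In
  the algebra of difference operators with polynomial coefficients the lowest and highest shifts are additive,
  so those of \<open>D\<close> agree with those of \<open>P(H)\<close>, which are \<open>\<plusminus> degree P\<close> (\<open>spans_eigen_op\<close>).  Finally, the degree of \<open>P\<close> is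
  \<open>degree \<Omega>\<^sub>G + 1\<close>, and \<open>degree \<Omega>\<^sub>G = \<Sum>\<^bsub>g \<in> G\<^esub> g - m (m - 1) / 2\<close>, as the leading coefficient is essentially a Vandermonde
  determinant (\<open>degree_casoratian_dual_charlier\<close>); the partition of \<open>{0, \<dots>, N - 1}\<close> turns this into the expression in \<open>F\<close>
  (\<open>order_formula\<close>).
\<close>

section \<open>Shifts of polynomials\<close>

lemma poly_real_eqI:
  fixes p q :: "real poly"
  assumes "\<And>x. poly p x = poly q x"
  shows "p = q"
  using assms poly_eq_poly_eq_iff by blast

lemma shift_poly_linear [simp]:
  "shift_poly l (p + q) = shift_poly l p + shift_poly l q"
  "shift_poly l (p - q) = shift_poly l p - shift_poly l q"
  "shift_poly l (p * q) = shift_poly l p * shift_poly l q"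
  "shift_poly l (smult c p) = smult c (shift_poly l p)"
  "shift_poly l 0 = 0"
  "shift_poly l 1 = 1"
  "shift_poly l [:c:] = [:c:]"
  "shift_poly 0 p = p"
  by (auto intro!: poly_real_eqI simp: poly_shift_poly)

lemma shift_poly_shift_poly [simp]: "shift_poly l (shift_poly k p) = shift_poly (l + k) p"
  by (rule poly_real_eqI) (simp add: poly_shift_poly add_ac)

lemma shift_poly_sum: "shift_poly l (sum f A) = (\<Sum>i\<in>A. shift_poly l (f i))"
  by (rule poly_real_eqI) (simp add: poly_shift_poly poly_sum)

lemma degree_shift_poly [simp]: "degree (shift_poly l p) = degree p"
  by (simp add: shift_poly_def degree_pcompose)

lemma shift_poly_eq_0_iff [simp]: "shift_poly l p = 0 \<longleftrightarrow> p = 0"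
  by (simp add: shift_poly_def pcompose_eq_0_iff)

section \<open>Charlier polynomials\<close>

lemma charlier_neg [simp]: "n < 0 \<Longrightarrow> charlier a n = 0"
  by (simp add: charlier_def)

text \<open>
  The coefficient \<open>n! / ((n - j)! j!)\<close> times \<open>j! / n!\<close> collapses, so that
  \<open>c\<^sub>n\<close> is the Cauchy product behind the generating function \<open>e\<^bsup>- a z\<^esup> (1 + z)\<^bsup>x\<^esup>\<close>.  This form makes the
  relations below comparisons of single terms.
\<close>

lemma poly_charlier:
  "poly (charlier a (int n)) x = (\<Sum>j\<le>n. (- a) ^ (n - j) / fact (n - j) * (x gchoose j))"
  unfolding charlier_def
  by (auto simp: poly_sum poly_binom_poly sum_distrib_left binomial_fact intro!: sum.cong)

lemma charlier_0 [simp]: "charlier a 0 = 1"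
  using poly_charlier[of a 0] by (intro poly_real_eqI) simp

lemma charlier_difference:
  "poly (charlier a n) (x + 1) - poly (charlier a n) x = poly (charlier a (n - 1)) x"
proof (cases "n \<le> 0")
  case True
  then show ?thesis by (cases "n = 0") auto
next
  case False
  then obtain k where n: "n = int (Suc k)" by (metis not_le zero_less_imp_eq_int gr0_implies_Suc)
  have "poly (charlier a (int (Suc k))) (x + 1) - poly (charlier a (int (Suc k))) x =
      (\<Sum>j\<le>Suc k. (- a) ^ (Suc k - j) / fact (Suc k - j) * ((x + 1 gchoose j) - (x gchoose j)))"
    by (simp only: poly_charlier sum_subtractf right_diff_distrib)
  also have "\<dots> = (\<Sum>j\<le>k. (- a) ^ (k - j) / fact (k - j) * (x gchoose j))"
    by (subst sum.atMost_Suc_shift) (simp add: gbinomial_Suc_Suc)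
  finally show ?thesis unfolding n by (simp add: poly_charlier)
qed

text \<open>
  The raising relation.  Multiplying \<open>c\<^sub>n(x - 1)\<close> by \<open>x\<close> turns \<open>binom(x - 1, j)\<close> into
  \<open>(j + 1) binom(x, j + 1)\<close>; on the left the factor \<open>n + 1\<close> splits as \<open>j + (n + 1 - j)\<close>, where \<open>j\<close> accounts
  for this term and \<open>n + 1 - j\<close> cancels against the factorial and leaves \<open>- a c\<^sub>n\<close>.
\<close>

lemma charlier_raise:
  "real (Suc n) * poly (charlier a (int (Suc n))) x =
     x * poly (charlier a (int n)) (x - 1) - a * poly (charlier a (int n)) x"
proof -
  define c where "c i = (- a) ^ i / fact i" for i :: nat
  have c_Suc: "real (Suc i) * c (Suc i) = - a * c i" for i
    by (simp add: c_def divide_simps del: of_nat_Suc)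
  have "real (Suc n) * poly (charlier a (int (Suc n))) x =
      (\<Sum>j\<le>Suc n. real (Suc n) * (c (Suc n - j) * (x gchoose j)))"
    unfolding poly_charlier by (simp only: sum_distrib_left c_def)
  also have "\<dots> = (\<Sum>j\<le>Suc n. c (Suc n - j) * (real j * (x gchoose j))) +
      (\<Sum>j\<le>Suc n. real (Suc n - j) * c (Suc n - j) * (x gchoose j))"
    unfolding sum.distrib[symmetric] by (intro sum.cong) (auto simp: of_nat_diff algebra_simps)
  also have "(\<Sum>j\<le>Suc n. c (Suc n - j) * (real j * (x gchoose j))) =
      (\<Sum>j\<le>n. c (n - j) * (x * (x - 1 gchoose j)))"
    by (subst sum.atMost_Suc_shift) (simp add: gbinomial_absorption del: of_nat_Suc)
  also have "(\<Sum>j\<le>Suc n. real (Suc n - j) * c (Suc n - j) * (x gchoose j)) =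
      (\<Sum>j\<le>n. - a * (c (n - j) * (x gchoose j)))"
  proof -
    have "real (Suc n - j) * c (Suc n - j) * (x gchoose j) = - a * (c (n - j) * (x gchoose j))"
      if "j \<le> n" for j
      unfolding Suc_diff_le[OF that] c_Suc by simp
    then show ?thesis by simp
  qed
  finally show ?thesis
    unfolding poly_charlier by (simp add: c_def sum_distrib_left algebra_simps sum_negf)
qed

text \<open>
  Raising after lowering: the raising relation for \<open>n - 1\<close>, in which \<open>c\<^bsub>n - 1\<^esub>\<close> is written as the
  difference of \<open>c\<^sub>n\<close>.
\<close>

lemma charlier_difference_equation:
  "- a * poly (charlier a n) (x + 1) + (x + a) * poly (charlier a n) x
     - x * poly (charlier a n) (x - 1) = of_int n * poly (charlier a n) x"
proof (cases "n \<le> 0")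
  case True
  then show ?thesis by (cases "n = 0") auto
next
  case False
  then obtain k where n: "n = int (Suc k)" by (metis not_le zero_less_imp_eq_int gr0_implies_Suc)
  show ?thesis
    using charlier_raise[of k a x] charlier_difference[of a n x] charlier_difference[of a n "x - 1"]
    unfolding n by (simp add: algebra_simps)
qed

lemma degree_binom_poly_le: "degree (binom_poly j) \<le> j"
  and coeff_binom_poly: "coeff (binom_poly j) j = 1 / fact j"
proof -
  have "degree (\<Prod>i<j. [:- real i, 1:]) = j"
    by (simp add: degree_prod_eq_sum_degree)
  moreover have "lead_coeff (\<Prod>i<j. [:- real i, 1:]) = 1"
    unfolding lead_coeff_prod by simp
  ultimately have "degree (\<Prod>i<j. [:- real i, 1:]) = j" "coeff (\<Prod>i<j. [:- real i, 1:]) j = 1"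
    by metis+
  then show "degree (binom_poly j) \<le> j" "coeff (binom_poly j) j = 1 / fact j"
    by (simp_all add: binom_poly_def)
qed

lemma degree_charlier_le: "degree (charlier a (int n)) \<le> n"
proof -
  have "degree (\<Sum>j\<le>n. smult ((- a) ^ (n - j) * real (n choose j) * fact j) (binom_poly j)) \<le> n"
    by (rule degree_sum_le) (auto intro!: order.trans[OF degree_smult_le] order.trans[OF degree_binom_poly_le])
  then show ?thesis by (simp add: charlier_def)
qed

lemma coeff_charlier: "coeff (charlier a (int n)) n = 1 / fact n"
proof -
  have "coeff (\<Sum>j\<le>n. smult ((- a) ^ (n - j) * real (n choose j) * fact j) (binom_poly j)) n =
      (\<Sum>j\<le>n. if j = n then 1 else 0)"
    unfolding coeff_sum
  proof (rule sum.cong)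
    fix j assume "j \<in> {..n}"
    then show "coeff (smult ((- a) ^ (n - j) * real (n choose j) * fact j) (binom_poly j)) n = (if j = n then 1 else 0)"
      using coeff_eq_0[of "binom_poly j" n] degree_binom_poly_le[of j] coeff_binom_poly[of j]
      by (cases "j = n") auto
  qed simp
  then show ?thesis by (simp add: charlier_def)
qed

lemma degree_charlier [simp]: "degree (charlier a (int n)) = n"
  using degree_charlier_le[of a n] coeff_charlier[of a n] le_degree[of "charlier a (int n)" n] by force

lemma coeff_charlier_gt: "i < n \<Longrightarrow> coeff (charlier a (int i)) n = 0"
  by (simp add: coeff_eq_0)

lemma charlier_basis:
  assumes "degree p \<le> n"
  shows "\<exists>\<alpha>. p = (\<Sum>i\<le>n. smult (\<alpha> i) (charlier a (int i)))"
  using assms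
proof (induction n arbitrary: p)
  case 0
  then obtain c where "p = [:c:]" by (metis degree_eq_zeroE le_zero_eq)
  then show ?case by (intro exI[of _ "\<lambda>_. c"]) simp
next
  case (Suc n)
  define c where "c = coeff p (Suc n) * fact (Suc n)"
  define p' where "p' = p - smult c (charlier a (int (Suc n)))"
  have "degree p' \<le> Suc n" unfolding p'_def
    by (rule degree_diff_le) (use Suc.prems degree_charlier[of a "Suc n"] in \<open>simp_all del: of_nat_Suc\<close>)
  moreover have "coeff p' (Suc n) = 0"
    using coeff_charlier[of a "Suc n"] by (simp add: p'_def c_def del: of_nat_Suc fact_Suc)
  ultimately have "degree p' \<le> n"
    by (metis le_SucE leading_coeff_0_iff degree_0 le0)
  then obtain \<alpha> where \<alpha>: "p' = (\<Sum>i\<le>n. smult (\<alpha> i) (charlier a (int i)))"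
    using Suc.IH by blast
  have "p = p' + smult c (charlier a (int (Suc n)))" by (simp add: p'_def)
  also have "\<dots> = (\<Sum>i\<le>Suc n. smult ((\<alpha>(Suc n := c)) i) (charlier a (int i)))"
    unfolding \<alpha> by simp
  finally show ?case by blast
qed

lemma coeff_charlier_sum: "coeff (\<Sum>i\<le>n. smult (\<alpha> i) (charlier a (int i))) n = \<alpha> n / fact n"
proof -
  have "coeff (\<Sum>i\<le>n. smult (\<alpha> i) (charlier a (int i))) n = (\<Sum>i\<le>n. if i = n then \<alpha> n / fact n else 0)"
    unfolding coeff_sum by (intro sum.cong) (auto simp: coeff_charlier coeff_charlier_gt)
  then show ?thesis by simp
qed

lemma degree_charlier_sum_le: "degree (\<Sum>i\<le>n. smult (\<alpha> i) (charlier a (int i))) \<le> n"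
  by (rule degree_sum_le) (auto intro!: order.trans[OF degree_smult_le])

definition forward_diff :: "real poly \<Rightarrow> real poly" where
  "forward_diff p = shift_poly 1 p - p"

lemma forward_diff_charlier [simp]: "forward_diff (charlier a n) = charlier a (n - 1)"
  by (rule poly_real_eqI) (simp add: forward_diff_def poly_shift_poly charlier_difference)

lemma forward_diff_charlier_sum:
  "forward_diff (\<Sum>i\<le>Suc n. smult (\<alpha> i) (charlier a (int i))) =
     (\<Sum>i\<le>n. smult (\<alpha> (Suc i)) (charlier a (int i)))"
proof -
  have "forward_diff (\<Sum>i\<le>Suc n. smult (\<alpha> i) (charlier a (int i))) =
      (\<Sum>i\<le>Suc n. smult (\<alpha> i) (forward_diff (charlier a (int i))))"
    by (simp only: forward_diff_def shift_poly_sum shift_poly_linear sum_subtractf smult_diff_right)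
  also have "\<dots> = (\<Sum>i\<le>n. smult (\<alpha> (Suc i)) (charlier a (int i)))"
    by (subst sum.atMost_Suc_shift) (simp, simp add: forward_diff_def)
  finally show ?thesis .
qed

text \<open>
  In the Charlier basis the forward difference is an index shift, which shows its effect on the
  degree and on the leading coefficient.
\<close>

lemma forward_diff_degree:
  assumes "degree p \<le> Suc n"
  shows "degree (forward_diff p) \<le> n"
    and "coeff (forward_diff p) n = real (Suc n) * coeff p (Suc n)"
proof -
  obtain \<alpha> where p: "p = (\<Sum>i\<le>Suc n. smult (\<alpha> i) (charlier 1 (int i)))"
    using charlier_basis[OF assms] by blast
  show "degree (forward_diff p) \<le> n"
    unfolding p forward_diff_charlier_sum by (rule degree_charlier_sum_le)
  show "coeff (forward_diff p) n = real (Suc n) * coeff p (Suc n)"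
    unfolding p forward_diff_charlier_sum coeff_charlier_sum by (simp add: divide_simps del: of_nat_Suc)
qed

text \<open>
  Shifting the indices of the Charlier expansion up by one inverts the forward difference.
\<close>

lemma forward_diff_antiderivative:
  assumes "Q \<noteq> 0"
  shows "\<exists>P. forward_diff P = Q \<and> degree P = Suc (degree Q)"
proof -
  define n where "n = degree Q"
  obtain \<alpha> where Q: "Q = (\<Sum>i\<le>n. smult (\<alpha> i) (charlier 1 (int i)))"
    using charlier_basis[of Q n] n_def by blast
  define P where "P = (\<Sum>i\<le>Suc n. smult (case i of 0 \<Rightarrow> 0 | Suc k \<Rightarrow> \<alpha> k) (charlier 1 (int i)))"
  have 1: "forward_diff P = Q" unfolding P_def forward_diff_charlier_sum Q by simp
  have "degree P \<le> Suc n" unfolding P_def by (rule degree_charlier_sum_le)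
  moreover have "coeff P (Suc n) \<noteq> 0"
    using forward_diff_degree(2)[OF \<open>degree P \<le> Suc n\<close>] 1 assms n_def by auto
  ultimately have "degree P = Suc n" using le_degree by force
  with 1 n_def show ?thesis by blast
qed

section \<open>The Charlier functional\<close>

lemma charlier_measure_add: "charlier_measure a (p + q) = charlier_measure a p + charlier_measure a q"
  using suminf_add[OF summable_charlier_measure[of a p] summable_charlier_measure[of a q]]
  by (simp add: charlier_measure_def algebra_simps)

lemma charlier_measure_smult: "charlier_measure a (smult c p) = c * charlier_measure a p"
  using suminf_mult[OF summable_charlier_measure[of a p], of c]
  by (simp add: charlier_measure_def algebra_simps)

lemma charlier_measure_0 [simp]: "charlier_measure a 0 = 0"
  by (simp add: charlier_measure_def)

lemma charlier_measure_diff: "charlier_measure a (p - q) = charlier_measure a p - charlier_measure a q"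
  using charlier_measure_add[of a "p - q" q] by simp

lemma charlier_measure_sum: "charlier_measure a (sum f A) = (\<Sum>i\<in>A. charlier_measure a (f i))"
  by (induction A rule: infinite_finite_induct) (simp_all add: charlier_measure_add)

lemma charlier_measure_1 [simp]: "charlier_measure a 1 = exp a"
  by (simp add: charlier_measure_def exp_def scaleR_conv_of_real field_simps)

text \<open>
  Summation by shifting the index: \<open>x a\<^bsup>x\<^esup> / x! = a \<cdot> a\<^bsup>x - 1\<^esup> / (x - 1)!\<close>.  All properties of the Charlier
  functional used below follow from linearity, this identity and the value at 1.
\<close>

lemma charlier_measure_shift:
  "charlier_measure a ([:0, 1:] * shift_poly (- 1) p) = a * charlier_measure a p"
proof -
  let ?f = "\<lambda>x. a ^ x / fact x * poly ([:0, 1:] * shift_poly (- 1) p) (real x)"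
  have "(\<Sum>x. ?f (Suc x)) = suminf ?f"
    using suminf_split_head[OF summable_charlier_measure[of a "[:0, 1:] * shift_poly (- 1) p"]] by simp
  moreover have "?f (Suc x) = a * (a ^ x / fact x * poly p (real x))" for x
    by (simp add: poly_shift_poly divide_simps del: of_nat_Suc) simp
  ultimately show ?thesis
    using suminf_mult[OF summable_charlier_measure[of a p], of a]
    unfolding charlier_measure_def by (simp only:)
qed

lemma charlier_raise_poly:
  "smult (real (Suc n)) (charlier a (int (Suc n))) =
     [:0, 1:] * shift_poly (- 1) (charlier a (int n)) - smult a (charlier a (int n))"
  using charlier_raise[of n a] by (intro poly_real_eqI) (simp add: poly_shift_poly)

text \<open>
  The adjoint form of the raising relation.  Iterated, it moves every lowering from \<open>c\<^sub>n\<close> to a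
  difference of \<open>p\<close>, and orthogonality becomes the vanishing of high differences.
\<close>

lemma charlier_measure_rodrigues:
  "real (Suc n) * charlier_measure a (charlier a (int (Suc n)) * p) =
     a * charlier_measure a (charlier a (int n) * forward_diff p)"
proof -
  let ?c = "charlier a (int n)"
  have "smult (real (Suc n)) (charlier a (int (Suc n)) * p) =
      [:0, 1:] * shift_poly (- 1) (?c * shift_poly 1 p) - smult a (?c * p)"
    using arg_cong[OF charlier_raise_poly[of n a], of "\<lambda>q. q * p"] by (simp add: algebra_simps)
  from arg_cong[OF this, of "charlier_measure a"]
  show ?thesis
    by (simp only: charlier_measure_smult charlier_measure_diff charlier_measure_shift
        forward_diff_def right_diff_distrib)
qed

lemma charlier_measure_orthogonal:
  "degree p < n \<Longrightarrow> charlier_measure a (charlier a (int n) * p) = 0"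
proof (induction n arbitrary: p)
  case (Suc n)
  have "charlier_measure a (charlier a (int n) * forward_diff p) = 0"
  proof (cases "degree p")
    case 0
    then obtain c where "p = [:c:]" by (rule degree_eq_zeroE)
    then show ?thesis by (simp add: forward_diff_def)
  next
    case (Suc k)
    with Suc.prems forward_diff_degree(1)[of p k] show ?thesis by (intro Suc.IH) simp
  qed
  then show ?case using charlier_measure_rodrigues[of n a p] by (simp del: of_nat_Suc)
qed simp

lemma charlier_measure_nonorthogonal:
  "\<lbrakk>a \<noteq> 0; degree p = n; p \<noteq> 0\<rbrakk> \<Longrightarrow> charlier_measure a (charlier a (int n) * p) \<noteq> 0"
proof (induction n arbitrary: p)
  case 0
  then obtain c where "p = [:c:]" by (blast elim: degree_eq_zeroE)
  with 0 charlier_measure_smult[of a c 1] show ?case by simp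
next
  case (Suc n)
  have "coeff p (Suc n) \<noteq> 0" using Suc.prems leading_coeff_0_iff[of p] by metis
  with forward_diff_degree[of p n] Suc.prems
  have "degree (forward_diff p) \<le> n" "coeff (forward_diff p) n \<noteq> 0" by auto
  then have "degree (forward_diff p) = n" "forward_diff p \<noteq> 0" using le_degree by force+
  with Suc have "charlier_measure a (charlier a (int n) * forward_diff p) \<noteq> 0" by blast
  with charlier_measure_rodrigues[of n a p] Suc.prems show ?case by (auto simp del: of_nat_Suc)
qed

lemma charlier_at_0: "poly (charlier a (int n)) 0 = (- a) ^ n / fact n"
proof -
  have "poly (charlier a (int n)) 0 = (\<Sum>j\<le>n. if j = 0 then (- a) ^ n / fact n else 0)"
    unfolding poly_charlier by (intro sum.cong) (auto simp: gbinomial_0_left)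
  then show ?thesis by simp
qed

lemma binom_poly_0 [simp]: "binom_poly 0 = 1" by (simp add: binom_poly_def)

lemma charlier_measure_binom_poly: "charlier_measure a (binom_poly j) = exp a * a ^ j / fact j"
proof (induction j)
  case (Suc j)
  have "smult (real (Suc j)) (binom_poly (Suc j)) = [:0, 1:] * shift_poly (- 1) (binom_poly j)"
    by (intro poly_real_eqI) (use gbinomial_absorption[of j] in \<open>simp add: poly_shift_poly poly_binom_poly\<close>)
  from arg_cong[OF this, of "charlier_measure a"]
  have "real (Suc j) * charlier_measure a (binom_poly (Suc j)) = a * charlier_measure a (binom_poly j)"
    by (simp only: charlier_measure_smult charlier_measure_shift)
  moreover have "fact (Suc j) * charlier_measure a (binom_poly (Suc j)) =
      fact j * (real (Suc j) * charlier_measure a (binom_poly (Suc j)))"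
    by (simp del: of_nat_Suc)
  ultimately have "fact (Suc j) * charlier_measure a (binom_poly (Suc j)) = exp a * a ^ Suc j"
    using Suc by (simp del: of_nat_Suc fact_Suc)
  then show ?case by (simp add: nonzero_eq_divide_eq mult.commute del: fact_Suc)
qed simp

text \<open>
  Up to a constant these are the moments of \<open>c\<^sub>n\<close> with respect to the Charlier weight divided by \<open>x + g + 1\<close>,
  with an additional point mass at \<open>- g - 1\<close>.  Both sides satisfy
  \<open>(n + 1) w\<^bsub>g, n + 1\<^esub> = (g + 1) w\<^bsub>g + 1, n\<^esub> - a w\<^bsub>g, n\<^esub>\<close>: on each side this is the raising relation, applied to
  \<open>c\<^bsub>n + 1\<^esub>\<close> on the left and to \<open>c\<^bsub>g + 1\<^esub>\<close> with parameter \<open>- a\<close> on the right.  This reduces the claim to \<open>n = 0\<close>,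
  which follows by induction on \<open>g\<close> from Pascal's rule.
\<close>

lemma charlier_measure_dual:
  "charlier_measure a (shift_poly (- 1) (binom_poly g) * shift_poly (- real g - 1) (charlier a (int n))) =
     exp a * (- 1) ^ n * poly (charlier (- a) (int g)) (- real n - 1)"
proof (induction n arbitrary: g)
  case 0
  show ?case
  proof (induction g)
    case (Suc g)
    have "(x - 1 gchoose Suc g) + (x - 1 gchoose g) = (x gchoose Suc g)" for x :: real
      using gbinomial_Suc_Suc[of "x - 1" g] by simp
    then have "shift_poly (- 1) (binom_poly (Suc g)) + shift_poly (- 1) (binom_poly g) = binom_poly (Suc g)"
      by (intro poly_real_eqI) (simp add: poly_shift_poly poly_binom_poly)
    from arg_cong[OF this, of "charlier_measure a"]
    have "charlier_measure a (shift_poly (- 1) (binom_poly (Suc g))) =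
        exp a * (a ^ Suc g / fact (Suc g) - poly (charlier (- a) (int g)) (- 1))"
      using Suc by (simp add: charlier_measure_add charlier_measure_binom_poly right_diff_distrib
          del: power_Suc fact_Suc)
    also have "a ^ Suc g / fact (Suc g) - poly (charlier (- a) (int g)) (- 1) =
        poly (charlier (- a) (int (Suc g))) (- 1)"
      using charlier_difference[of "- a" "int (Suc g)" "- 1"] charlier_at_0[of "- a" "Suc g"]
      by (simp del: power_Suc fact_Suc)
    finally show ?case by simp
  qed simp
next
  case (Suc n)
  let ?w = "\<lambda>g n. shift_poly (- 1) (binom_poly g) * shift_poly (- real g - 1) (charlier a (int n))"
  have "smult (real (Suc n)) (?w g (Suc n)) = smult (real (Suc g)) (?w (Suc g) n) - smult a (?w g n)"
  proof (rule poly_real_eqI)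
    fix x
    let ?c = "\<lambda>n. poly (charlier a (int n))" and ?y = "x - real g - 1"
    have B: "?y * (x - 1 gchoose g) = real (Suc g) * (x - 1 gchoose Suc g)"
      using gbinomial_mult_1[of "x - 1" g] by (simp add: algebra_simps)
    have "real (Suc n) * ((x - 1 gchoose g) * ?c (Suc n) ?y) =
        (x - 1 gchoose g) * (real (Suc n) * ?c (Suc n) ?y)" by (simp only: mult_ac)
    also have "\<dots> = (?y * (x - 1 gchoose g)) * ?c n (?y - 1) - a * ((x - 1 gchoose g) * ?c n ?y)"
      unfolding charlier_raise by (simp only: algebra_simps)
    finally show "poly (smult (real (Suc n)) (?w g (Suc n))) x =
        poly (smult (real (Suc g)) (?w (Suc g) n) - smult a (?w g n)) x"
      unfolding B by (simp add: poly_shift_poly poly_binom_poly mult.assoc algebra_simps del: of_nat_Suc)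
        (simp add: algebra_simps)
  qed
  from arg_cong[OF this, of "charlier_measure a"]
  have "real (Suc n) * charlier_measure a (?w g (Suc n)) =
      real (Suc g) * charlier_measure a (?w (Suc g) n) - a * charlier_measure a (?w g n)"
    by (simp only: charlier_measure_smult charlier_measure_diff)
  also have "\<dots> = exp a * (- 1) ^ n * (real (Suc g) * poly (charlier (- a) (int (Suc g))) (- real n - 1)
      - a * poly (charlier (- a) (int g)) (- real n - 1))"
    unfolding Suc.IH by (simp only: algebra_simps)
  also have "\<dots> = exp a * (- 1) ^ n * ((- real n - 1) * poly (charlier (- a) (int g)) (- real n - 1 - 1))"
    unfolding charlier_raise by simp
  also have "\<dots> = real (Suc n) * (exp a * (- 1) ^ Suc n * poly (charlier (- a) (int g)) (- real (Suc n) - 1))"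
    by (simp add: algebra_simps)
  finally show ?case by (metis mult_left_cancel of_nat_neq_0)
qed

text \<open>
  Both sides equal \<open>\<Sum>\<^sub>j binom(g, j) binom(t, j) j! / a\<^bsup>j\<^esup>\<close>, which is symmetric in \<open>g\<close> and \<open>t\<close>.  So, up
  to the factor \<open>a\<^bsup>g\<^esup> / g!\<close>, the value \<open>c\<^sub>g(t)\<close> is a polynomial in \<open>g\<close> of degree \<open>t\<close>.
\<close>

lemma charlier_duality:
  assumes "a \<noteq> 0"
  shows "fact g * poly (charlier (- a) (int g)) (real t) / a ^ g =
     fact t * poly (charlier (- a) (int t)) (real g) / a ^ t"
proof -
  define S where "S g t = (\<Sum>j\<le>g + t. real (g choose j) * real (t choose j) * fact j / a ^ j)" for g t
  have "fact g * poly (charlier (- a) (int g)) (real t) / a ^ g = S g t" for g t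
  proof -
    have "S g t = (\<Sum>j\<le>g. real (g choose j) * real (t choose j) * fact j / a ^ j)"
      unfolding S_def by (rule sum.mono_neutral_right) auto
    also have "\<dots> = fact g * poly (charlier (- a) (int g)) (real t) / a ^ g"
      unfolding poly_charlier sum_distrib_left sum_divide_distrib
    proof (rule sum.cong)
      fix j assume "j \<in> {..g}"
      then have "a ^ g = a ^ j * a ^ (g - j)" by (simp flip: power_add)
      then show "real (g choose j) * real (t choose j) * fact j / a ^ j =
          fact g * ((- (- a)) ^ (g - j) / fact (g - j) * (real t gchoose j)) / a ^ g"
        using \<open>j \<in> {..g}\<close> assms binomial_fact[of j g, where 'a = real]
        by (simp add: binomial_gbinomial[symmetric])
    qed simp
    finally show ?thesis ..
  qed
  moreover have "S g t = S t g" by (simp add: S_def mult_ac add.commute)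
  ultimately show ?thesis by metis
qed

section \<open>The algebra of difference operators\<close>

text \<open>
  A difference operator is represented by its family of coefficients, indexed by the shift; only
  families of finite support are meaningful.  Keeping the coefficients apart from the map on polynomials
  makes the lowest and the highest shift visible.
\<close>

definition dop :: "(int \<Rightarrow> real poly) \<Rightarrow> real poly \<Rightarrow> real poly" where
  "dop h p = (\<Sum>l | h l \<noteq> 0. h l * shift_poly (of_int l) p)"

abbreviation fin_supp :: "(int \<Rightarrow> real poly) \<Rightarrow> bool" where
  "fin_supp h \<equiv> finite {l. h l \<noteq> 0}"

lemma dop_superset:
  assumes "finite A" and "{l. h l \<noteq> 0} \<subseteq> A"
  shows "dop h p = (\<Sum>l\<in>A. h l * shift_poly (of_int l) p)"
  unfolding dop_def by (rule sum.mono_neutral_left) (use assms in auto)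

lemma smult_sum_right: "smult c (sum f A) = (\<Sum>i\<in>A. smult c (f i))"
  by (induction A rule: infinite_finite_induct) (simp_all add: smult_add_right)

lemma dop_linear:
  "dop h 0 = 0" "dop h (p + q) = dop h p + dop h q" "dop h (smult c p) = smult c (dop h p)"
  by (simp_all add: dop_def distrib_left sum.distrib smult_sum_right)

lemma dop_sum_right: "dop h (sum f A) = (\<Sum>i\<in>A. dop h (f i))"
  by (induction A rule: infinite_finite_induct) (simp_all add: dop_linear)

lemma fin_supp_add:
  assumes "fin_supp h" and "fin_supp k"
  shows "fin_supp (\<lambda>l. h l + k l)"
  by (rule finite_subset[OF _ finite_UnI[OF assms]]) auto

lemma dop_add:
  assumes "fin_supp h" and "fin_supp k"
  shows "dop (\<lambda>l. h l + k l) p = dop h p + dop k p"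
proof -
  let ?A = "{l. h l \<noteq> 0} \<union> {l. k l \<noteq> 0}"
  have A: "finite ?A" using assms by simp
  have "dop h p = (\<Sum>l\<in>?A. h l * shift_poly (of_int l) p)"
    "dop k p = (\<Sum>l\<in>?A. k l * shift_poly (of_int l) p)"
    "dop (\<lambda>l. h l + k l) p = (\<Sum>l\<in>?A. (h l + k l) * shift_poly (of_int l) p)"
    by (rule dop_superset[OF A]; force)+
  then show ?thesis by (simp add: distrib_right sum.distrib)
qed

lemma fin_supp_smult:
  assumes "fin_supp h"
  shows "fin_supp (\<lambda>l. smult c (h l))"
  by (rule finite_subset[OF _ assms]) auto

lemma dop_smult: "fin_supp h \<Longrightarrow> dop (\<lambda>l. smult c (h l)) p = smult c (dop h p)"
  using dop_superset[of "{l. h l \<noteq> 0}" "\<lambda>l. smult c (h l)" p]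
  by (auto simp: dop_def smult_sum_right)

lemma fin_supp_sum:
  assumes "finite I" and "\<And>i. i \<in> I \<Longrightarrow> fin_supp (h i)"
  shows "fin_supp (\<lambda>l. \<Sum>i\<in>I. h i l)"
proof (rule finite_subset)
  show "{l. (\<Sum>i\<in>I. h i l) \<noteq> 0} \<subseteq> (\<Union>i\<in>I. {l. h i l \<noteq> 0})"
  proof
    fix l assume "l \<in> {l. (\<Sum>i\<in>I. h i l) \<noteq> 0}"
    then have "(\<Sum>i\<in>I. h i l) \<noteq> 0" by simp
    then obtain i where "i \<in> I" "h i l \<noteq> 0" by (rule sum.not_neutral_contains_not_neutral)
    then show "l \<in> (\<Union>i\<in>I. {l. h i l \<noteq> 0})" by blast
  qed
  show "finite (\<Union>i\<in>I. {l. h i l \<noteq> 0})" using assms by blast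
qed

lemma dop_sum:
  assumes "finite I" and "\<And>i. i \<in> I \<Longrightarrow> fin_supp (h i)"
  shows "dop (\<lambda>l. \<Sum>i\<in>I. h i l) p = (\<Sum>i\<in>I. dop (h i) p)"
  using assms
proof (induction I rule: finite_induct)
  case (insert i I)
  then show ?case using dop_add[of "h i" "\<lambda>l. \<Sum>i\<in>I. h i l" p] fin_supp_sum[of I h] by simp
qed (simp add: dop_def)

text \<open>
  The coefficients of a composition: \<open>h\<^sub>i S\<^sub>i (k\<^sub>j S\<^sub>j) = h\<^sub>i S\<^sub>i(k\<^sub>j) S\<^bsub>i + j\<^esub>\<close>.
\<close>

definition dmul :: "(int \<Rightarrow> real poly) \<Rightarrow> (int \<Rightarrow> real poly) \<Rightarrow> int \<Rightarrow> real poly" where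
  "dmul h k l = (\<Sum>i | h i \<noteq> 0. h i * shift_poly (of_int i) (k (l - i)))"

lemma dmul_nonzeroE:
  assumes "dmul h k l \<noteq> 0"
  obtains i where "h i \<noteq> 0" "k (l - i) \<noteq> 0"
proof -
  obtain i where "h i * shift_poly (of_int i) (k (l - i)) \<noteq> 0"
    using assms unfolding dmul_def by (rule sum.not_neutral_contains_not_neutral)
  then show thesis by (intro that[of i]) auto
qed

lemma fin_supp_dmul:
  assumes "fin_supp h" and "fin_supp k"
  shows "fin_supp (dmul h k)"
proof (rule finite_subset)
  show "{l. dmul h k l \<noteq> 0} \<subseteq> (\<lambda>(i, j). i + j) ` ({l. h l \<noteq> 0} \<times> {l. k l \<noteq> 0})"
  proof
    fix l assume "l \<in> {l. dmul h k l \<noteq> 0}"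
    then obtain i where "h i \<noteq> 0" "k (l - i) \<noteq> 0" by (auto elim: dmul_nonzeroE)
    then show "l \<in> (\<lambda>(i, j). i + j) ` ({l. h l \<noteq> 0} \<times> {l. k l \<noteq> 0})"
      by (intro image_eqI[of _ _ "(i, l - i)"]) auto
  qed
qed (use assms in simp)

lemma dop_dmul:
  assumes "fin_supp h" and "fin_supp k"
  shows "dop (dmul h k) p = dop h (dop k p)"
proof -
  let ?H = "{l. h l \<noteq> 0}" and ?K = "{l. k l \<noteq> 0}"
  define A where "A = (\<lambda>(i, j). i + j) ` (?H \<times> ?K)"
  have A: "finite A" using assms by (simp add: A_def)
  have "{l. dmul h k l \<noteq> 0} \<subseteq> A"
  proof
    fix l assume "l \<in> {l. dmul h k l \<noteq> 0}"
    then obtain i where "h i \<noteq> 0" "k (l - i) \<noteq> 0" by (auto elim: dmul_nonzeroE)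
    then show "l \<in> A" unfolding A_def by (intro image_eqI[of _ _ "(i, l - i)"]) auto
  qed
  then have "dop (dmul h k) p = (\<Sum>l\<in>A. dmul h k l * shift_poly (of_int l) p)"
    by (rule dop_superset[OF A])
  also have "\<dots> = (\<Sum>i\<in>?H. \<Sum>l\<in>A. h i * shift_poly (of_int i) (k (l - i)) * shift_poly (of_int l) p)"
    unfolding dmul_def sum_distrib_right by (rule sum.swap)
  also have "\<dots> = (\<Sum>i\<in>?H. h i * shift_poly (of_int i) (dop k p))"
  proof (rule sum.cong)
    fix i assume i: "i \<in> ?H"
    have "shift_poly (of_int i) (dop k p) =
        (\<Sum>j\<in>?K. shift_poly (of_int i) (k j) * shift_poly (of_int (j + i)) p)"
      by (simp add: dop_def shift_poly_sum add.commute)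
    also have "\<dots> = (\<Sum>l\<in>(\<lambda>j. j + i) ` ?K. shift_poly (of_int i) (k (l - i)) * shift_poly (of_int l) p)"
      by (subst sum.reindex) (auto simp: inj_on_def)
    also have "\<dots> = (\<Sum>l\<in>A. shift_poly (of_int i) (k (l - i)) * shift_poly (of_int l) p)"
    proof (rule sum.mono_neutral_left[OF A])
      show "(\<lambda>j. j + i) ` ?K \<subseteq> A"
        using i unfolding A_def by (auto intro!: image_eqI[of _ _ "(i, _)"])
      show "\<forall>l\<in>A - (\<lambda>j. j + i) ` ?K. shift_poly (of_int i) (k (l - i)) * shift_poly (of_int l) p = 0"
      proof
        fix l assume "l \<in> A - (\<lambda>j. j + i) ` ?K"
        moreover have "l \<in> (\<lambda>j. j + i) ` ?K" if "k (l - i) \<noteq> 0"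
          using that by (intro image_eqI[of _ _ "l - i"]) auto
        ultimately show "shift_poly (of_int i) (k (l - i)) * shift_poly (of_int l) p = 0" by auto
      qed
    qed
    finally show "(\<Sum>l\<in>A. h i * shift_poly (of_int i) (k (l - i)) * shift_poly (of_int l) p) =
        h i * shift_poly (of_int i) (dop k p)"
      by (simp add: sum_distrib_left mult.assoc)
  qed simp
  finally show ?thesis by (simp add: dop_def)
qed

text \<open>
  The coefficient of the shift \<open>m\<close> at a point \<open>x\<close> is read off by applying the operator to a
  polynomial that vanishes at \<open>x + l\<close> for all other shifts \<open>l\<close> of the two operators.
\<close>

lemma dop_inject:
  assumes "fin_supp h" and "fin_supp k" and "\<And>p. dop h p = dop k p"
  shows "h = k"
proof
  fix m
  define A where "A = insert m ({l. h l \<noteq> 0} \<union> {l. k l \<noteq> 0})"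
  have A: "finite A" "m \<in> A" using assms by (simp_all add: A_def)
  show "h m = k m"
  proof (rule poly_real_eqI)
    fix x :: real
    \<comment> \<open>Zero at x + l for every occurring shift l other than m.\<close>
    define p where "p = (\<Prod>l\<in>A - {m}. [:- (x + of_int l), 1:])"
    have p: "poly p (x + of_int l) = 0" if "l \<in> A - {m}" for l
      unfolding p_def poly_prod using that A by (intro prod_zero) auto
    have pm: "poly p (x + of_int m) \<noteq> 0"
      unfolding p_def poly_prod using A by simp
    have *: "poly (dop f p) x = poly (f m) x * poly p (x + of_int m)"
      if "{l. f l \<noteq> 0} \<subseteq> A" for f
    proof -
      have "poly (dop f p) x = (\<Sum>l\<in>A. poly (f l) x * poly p (x + of_int l))"
        by (simp add: dop_superset[OF A(1) that] poly_sum poly_shift_poly)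
      also have "\<dots> = poly (f m) x * poly p (x + of_int m)"
        using A p by (simp add: sum.remove[of A m])
      finally show ?thesis .
    qed
    have "{l. h l \<noteq> 0} \<subseteq> A" "{l. k l \<noteq> 0} \<subseteq> A" by (auto simp: A_def)
    with *[of h] *[of k] assms(3)[of p] pm show "poly (h m) x = poly (k m) x" by simp
  qed
qed

definition spans :: "(int \<Rightarrow> real poly) \<Rightarrow> int \<Rightarrow> int \<Rightarrow> bool" where
  "spans h s r \<longleftrightarrow> h s \<noteq> 0 \<and> h r \<noteq> 0 \<and> (\<forall>l. h l \<noteq> 0 \<longrightarrow> s \<le> l \<and> l \<le> r)"

lemma spans_fin_supp: "spans h s r \<Longrightarrow> fin_supp h"
  by (rule finite_subset[of _ "{s..r}"]) (auto simp: spans_def)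

lemma spans_unique: "spans h s r \<Longrightarrow> spans h s' r' \<Longrightarrow> s = s' \<and> r = r'"
  unfolding spans_def by (meson order_antisym)

lemma spans_exists:
  assumes "fin_supp h" and "h l \<noteq> 0"
  obtains s r where "spans h s r"
proof
  let ?S = "{l. h l \<noteq> 0}"
  have "?S \<noteq> {}" using assms by auto
  then show "spans h (Min ?S) (Max ?S)"
    using Min_in[OF assms(1)] Max_in[OF assms(1)] Min_le[OF assms(1)] Max_ge[OF assms(1)]
    by (auto simp: spans_def)
qed

text \<open>
  The extreme coefficients of a product are products of extreme coefficients, up to a shift of the
  argument.  Since polynomials have no zero divisors, they do not vanish: the algebra of difference
  operators is a graded domain.
\<close>

lemma spans_dmul:
  assumes h: "spans h s r" and k: "spans k s' r'"
  shows "spans (dmul h k) (s + s') (r + r')"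
proof -
  note fin = spans_fin_supp[OF h]
  have "dmul h k (s + s') = h s * shift_poly (of_int s) (k s')"
  proof -
    have "dmul h k (s + s') = (\<Sum>i\<in>{s}. h i * shift_poly (of_int i) (k (s + s' - i)))"
      unfolding dmul_def
    proof (rule sum.mono_neutral_right[OF fin])
      show "\<forall>i\<in>{l. h l \<noteq> 0} - {s}. h i * shift_poly (of_int i) (k (s + s' - i)) = 0"
      proof
        fix i assume "i \<in> {l. h l \<noteq> 0} - {s}"
        then have "h i \<noteq> 0" "i \<noteq> s" by auto
        then have "s \<le> i" using h unfolding spans_def by blast
        with \<open>i \<noteq> s\<close> have "\<not> s' \<le> s + s' - i" by simp
        then have "k (s + s' - i) = 0" using k unfolding spans_def by blast
        then show "h i * shift_poly (of_int i) (k (s + s' - i)) = 0" by simp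
      qed
    qed (use h in \<open>auto simp: spans_def\<close>)
    then show ?thesis by simp
  qed
  moreover have "dmul h k (r + r') = h r * shift_poly (of_int r) (k r')"
  proof -
    have "dmul h k (r + r') = (\<Sum>i\<in>{r}. h i * shift_poly (of_int i) (k (r + r' - i)))"
      unfolding dmul_def
    proof (rule sum.mono_neutral_right[OF fin])
      show "\<forall>i\<in>{l. h l \<noteq> 0} - {r}. h i * shift_poly (of_int i) (k (r + r' - i)) = 0"
      proof
        fix i assume "i \<in> {l. h l \<noteq> 0} - {r}"
        then have "h i \<noteq> 0" "i \<noteq> r" by auto
        then have "i \<le> r" using h unfolding spans_def by blast
        with \<open>i \<noteq> r\<close> have "\<not> r + r' - i \<le> r'" by simp
        then have "k (r + r' - i) = 0" using k unfolding spans_def by blast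
        then show "h i * shift_poly (of_int i) (k (r + r' - i)) = 0" by simp
      qed
    qed (use h in \<open>auto simp: spans_def\<close>)
    then show ?thesis by simp
  qed
  moreover have "s + s' \<le> l \<and> l \<le> r + r'" if nz: "dmul h k l \<noteq> 0" for l
  proof -
    obtain i where "h i \<noteq> 0" "k (l - i) \<noteq> 0" using dmul_nonzeroE[OF nz] by blast
    then have "s \<le> i" "i \<le> r" "s' \<le> l - i" "l - i \<le> r'" using h k unfolding spans_def by blast+
    then show ?thesis by simp
  qed
  ultimately show ?thesis using h k by (simp add: spans_def)
qed

primrec dpow :: "(int \<Rightarrow> real poly) \<Rightarrow> nat \<Rightarrow> int \<Rightarrow> real poly" where
  "dpow h 0 = (\<lambda>l. if l = 0 then 1 else 0)"
| "dpow h (Suc i) = dmul h (dpow h i)"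

definition dpoly :: "(int \<Rightarrow> real poly) \<Rightarrow> real poly \<Rightarrow> int \<Rightarrow> real poly" where
  "dpoly h P l = (\<Sum>i\<le>degree P. smult (coeff P i) (dpow h i l))"

lemma fin_supp_dpow: "fin_supp h \<Longrightarrow> fin_supp (dpow h i)"
  by (induction i) (auto intro: fin_supp_dmul)

lemma fin_supp_dpoly: "fin_supp h \<Longrightarrow> fin_supp (dpoly h P)"
  unfolding dpoly_def by (intro fin_supp_sum fin_supp_smult fin_supp_dpow) auto

lemma dop_dpow_eigen:
  assumes "fin_supp h" and "dop h p = smult c p"
  shows "dop (dpow h i) p = smult (c ^ i) p"
proof (induction i)
  case 0
  show ?case using dop_superset[of "{0}" "dpow h 0" p] by auto
next
  case (Suc i)
  then show ?case using assms by (simp add: dop_dmul fin_supp_dpow dop_linear mult.commute)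
qed

lemma dop_dpoly_eigen:
  assumes "fin_supp h" and "dop h p = smult c p"
  shows "dop (dpoly h P) p = smult (poly P c) p"
proof -
  have "dop (dpoly h P) p = (\<Sum>i\<le>degree P. smult (coeff P i * c ^ i) p)"
    unfolding dpoly_def
    by (subst dop_sum) (simp_all add: fin_supp_smult fin_supp_dpow assms dop_smult dop_dpow_eigen)
  then show ?thesis by (simp add: smult_sum poly_altdef)
qed

lemma spans_dpow: "spans h (- 1) 1 \<Longrightarrow> spans (dpow h i) (- int i) (int i)"
proof (induction i)
  case (Suc i)
  from spans_dmul[OF Suc.prems Suc.IH[OF Suc.prems]] show ?case by simp
qed (simp add: spans_def)

lemma spans_dpoly:
  assumes "spans h (- 1) 1" and "P \<noteq> 0"
  shows "spans (dpoly h P) (- int (degree P)) (int (degree P))"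
proof -
  let ?d = "degree P"
  have pow: "dpow h i l = 0" if "int i < \<bar>l\<bar>" for i l
  proof (rule ccontr)
    assume "dpow h i l \<noteq> 0"
    then have "- int i \<le> l" "l \<le> int i" using spans_dpow[OF assms(1), of i] unfolding spans_def by blast+
    with that show False by simp
  qed
  have "dpoly h P l = smult (coeff P ?d) (dpow h ?d l)" if "\<bar>l\<bar> = int ?d" for l
  proof -
    have "dpoly h P l = (\<Sum>i\<in>{?d}. smult (coeff P i) (dpow h i l))"
      unfolding dpoly_def by (rule sum.mono_neutral_right) (use that pow in auto)
    then show ?thesis by simp
  qed
  from this[of "int ?d"] this[of "- int ?d"]
  have "dpoly h P (int ?d) \<noteq> 0" "dpoly h P (- int ?d) \<noteq> 0"
    using spans_dpow[OF assms(1), of ?d] assms(2) by (auto simp: spans_def)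
  moreover have "dpoly h P l = 0" if "int ?d < \<bar>l\<bar>" for l
    unfolding dpoly_def using that pow by (intro sum.neutral) auto
  then have "- int ?d \<le> l \<and> l \<le> int ?d" if "dpoly h P l \<noteq> 0" for l
    using that by (cases "int ?d < \<bar>l\<bar>") auto
  ultimately show ?thesis by (simp add: spans_def)
qed

text \<open>
  The second order operator of the Charlier difference equation; \<open>c\<^sub>n\<close> is an eigenfunction for the
  eigenvalue \<open>n\<close>.  Polynomials in this operator act on the Charlier basis by multiplication with
  polynomials in \<open>n\<close>.
\<close>

definition charlier_op :: "real \<Rightarrow> int \<Rightarrow> real poly" where
  "charlier_op a l = (if l = 1 then [:- a:] else if l = 0 then [:a, 1:] else if l = - 1 then [:0, - 1:] else 0)"

lemma spans_charlier_op: "a \<noteq> 0 \<Longrightarrow> spans (charlier_op a) (- 1) 1"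
  by (auto simp: spans_def charlier_op_def split: if_splits)

lemma fin_supp_charlier_op: "fin_supp (charlier_op a)"
  by (rule finite_subset[of _ "{- 1, 0, 1}"]) (auto simp: charlier_op_def split: if_splits)

lemma dop_charlier_op: "dop (charlier_op a) (charlier a n) = smult (of_int n) (charlier a n)"
proof -
  have "dop (charlier_op a) (charlier a n) =
      (\<Sum>l\<in>{- 1, 0, 1}. charlier_op a l * shift_poly (of_int l) (charlier a n))"
    by (rule dop_superset) (auto simp: charlier_op_def split: if_splits)
  also have "\<dots> = smult (of_int n) (charlier a n)"
  proof (rule poly_real_eqI)
    fix x
    show "poly (\<Sum>l\<in>{- 1, 0, 1}. charlier_op a l * shift_poly (of_int l) (charlier a n)) x =
        poly (smult (of_int n) (charlier a n)) x"
      using charlier_difference_equation[of a n x]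
      by (simp add: charlier_op_def poly_shift_poly algebra_simps)
  qed
  finally show ?thesis .
qed

definition fwd_op :: "int \<Rightarrow> real poly" where
  "fwd_op l = (if l = 1 then 1 else if l = 0 then - 1 else 0)"

definition bwd_op :: "int \<Rightarrow> real poly" where
  "bwd_op l = (if l = 0 then 1 else if l = - 1 then - 1 else 0)"

lemma fin_supp_fwd_op: "fin_supp fwd_op" and fin_supp_bwd_op: "fin_supp bwd_op"
  by (rule finite_subset[of _ "{- 1, 0, 1}"]; auto simp: fwd_op_def bwd_op_def split: if_splits)+

lemma dop_fwd_op_charlier: "dop fwd_op (charlier a n) = charlier a (n - 1)"
proof -
  have "dop fwd_op p = forward_diff p" for p
  proof -
    have "dop fwd_op p = (\<Sum>l\<in>{0, 1}. fwd_op l * shift_poly (of_int l) p)"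
      by (rule dop_superset) (auto simp: fwd_op_def split: if_splits)
    then show ?thesis by (simp add: fwd_op_def forward_diff_def)
  qed
  then show ?thesis by simp
qed

lemma dop_fwd_op_pow: "dop (dpow fwd_op j) (charlier a n) = charlier a (n - int j)"
proof (induction j)
  case 0
  show ?case using dop_superset[of "{0}" "dpow fwd_op 0"] by auto
next
  case (Suc j)
  then show ?case
    by (simp add: dop_dmul fin_supp_dpow fin_supp_fwd_op dop_fwd_op_charlier algebra_simps)
qed

lemma charlier_shift_minus_1:
  assumes "n < int K"
  shows "shift_poly (- 1) (charlier a n) = (\<Sum>i<K. smult ((- 1) ^ i) (charlier a (n - int i)))"
  using assms
proof (induction K arbitrary: n)
  case (Suc K)
  have "shift_poly (- 1) (charlier a n) = charlier a n - shift_poly (- 1) (charlier a (n - 1))"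
  proof (rule poly_real_eqI)
    fix x
    show "poly (shift_poly (- 1) (charlier a n)) x =
        poly (charlier a n - shift_poly (- 1) (charlier a (n - 1))) x"
      using charlier_difference[of a n "x - 1"] by (simp add: poly_shift_poly)
  qed
  also have "shift_poly (- 1) (charlier a (n - 1)) = (\<Sum>i<K. smult ((- 1) ^ i) (charlier a (n - 1 - int i)))"
    by (rule Suc.IH) (use Suc.prems in simp)
  also have "charlier a n - \<dots> = (\<Sum>i<Suc K. smult ((- 1) ^ i) (charlier a (n - int i)))"
    by (subst sum.lessThan_Suc_shift) (simp add: sum_negf algebra_simps)
  finally show ?case .
qed simp

text \<open>
  The backward difference of \<open>c\<^sub>n\<close> is an alternating sum of all earlier Charlier polynomials, as
  \<open>1 - (1 + L)\<^bsup>- 1\<^esup>\<close> is a geometric series in the lowering operator \<open>L\<close>.  The number \<open>K\<close> of terms is arbitrary as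
  long as it reaches the index 0, beyond which all terms are 0; this freedom allows a common range of
  summation for several \<open>n\<close>.
\<close>

lemma dop_bwd_op_charlier:
  assumes "n \<le> int K"
  shows "dop bwd_op (charlier a n) = (\<Sum>i=1..K. smult (- ((- 1) ^ i)) (charlier a (n - int i)))"
proof -
  have "dop bwd_op (charlier a n) = charlier a n - shift_poly (- 1) (charlier a n)"
  proof -
    have "dop bwd_op (charlier a n) = (\<Sum>l\<in>{- 1, 0}. bwd_op l * shift_poly (of_int l) (charlier a n))"
      by (rule dop_superset) (auto simp: bwd_op_def split: if_splits)
    then show ?thesis by (simp add: bwd_op_def)
  qed
  also have "shift_poly (- 1) (charlier a n) = (\<Sum>i\<le>K. smult ((- 1) ^ i) (charlier a (n - int i)))"
    using charlier_shift_minus_1[of n "Suc K" a] assms by (simp only: lessThan_Suc_atMost)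
  also have "\<dots> = charlier a n + (\<Sum>i=1..K. smult ((- 1) ^ i) (charlier a (n - int i)))"
    by (simp add: atMost_atLeast0 sum.atLeast_Suc_atMost)
  finally show ?thesis by (simp add: sum_negf)
qed

section \<open>Cofactors of Casorati matrices\<close>

lemma cofactor_row_orthogonal:
  assumes A: "(A :: 'a :: comm_ring_1 mat) \<in> carrier_mat n n" and "i < n" "k < n" "i \<noteq> k"
  shows "(\<Sum>j<n. A $$ (i, j) * cofactor A k j) = 0"
proof -
  have "(\<Sum>j<n. A $$ (i, j) * cofactor A k j) = (A * adj_mat A) $$ (i, k)"
    using assms by (auto simp: times_mat_def scalar_prod_def adj_mat_def atLeast0LessThan intro!: sum.cong)
  then show ?thesis using assms by (simp add: adj_mat(2)[OF A])
qed

lemma cofactor_col_orthogonal: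
  assumes A: "(A :: 'a :: comm_ring_1 mat) \<in> carrier_mat n n" and "j < n" "k < n"
  shows "(\<Sum>i<n. cofactor A i k * A $$ (i, j)) = (if j = k then det A else 0)"
proof -
  have "(\<Sum>i<n. cofactor A i k * A $$ (i, j)) = (adj_mat A * A) $$ (k, j)"
    using assms by (auto simp: times_mat_def scalar_prod_def adj_mat_def atLeast0LessThan intro!: sum.cong)
  then show ?thesis using assms by (auto simp: adj_mat(3)[OF A])
qed

definition casorati_mat :: "(nat \<Rightarrow> real poly) \<Rightarrow> nat \<Rightarrow> real poly mat" where
  "casorati_mat y m = mat m m (\<lambda>(l, r). shift_poly (- real (Suc r)) (y l))"

definition casoratian :: "(nat \<Rightarrow> real poly) \<Rightarrow> nat \<Rightarrow> real poly" where
  "casoratian y m = det (casorati_mat y m)"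

text \<open>
  The Casorati matrix with the additional column \<open>y\<^sub>l(x)\<close> in front and a row on top.  The top row holds the
  place of the Charlier polynomials in \<open>q\<^sub>n\<close>, which are polynomials in another variable; the determinant enters
  through its cofactors along this row.
\<close>

definition bordered_mat :: "(nat \<Rightarrow> real poly) \<Rightarrow> nat \<Rightarrow> real poly mat" where
  "bordered_mat y m =
     mat (Suc m) (Suc m) (\<lambda>(i, j). if i = 0 then 0 else shift_poly (- real j) (y (i - 1)))"

definition border_cof :: "(nat \<Rightarrow> real poly) \<Rightarrow> nat \<Rightarrow> nat \<Rightarrow> real poly" where
  "border_cof y m j = cofactor (bordered_mat y m) 0 j"

text \<open>
  In the cofactor of column \<open>t\<close>, the argument is shifted such that the deleted column becomes the one
  with the values \<open>y\<^sub>l(x)\<close>.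
\<close>

definition cofactor_sum :: "(nat \<Rightarrow> real poly) \<Rightarrow> nat \<Rightarrow> nat \<Rightarrow> real poly" where
  "cofactor_sum y m h = (\<Sum>t<m. shift_poly (real (Suc t)) (cofactor (casorati_mat y m) h t))"

lemma casorati_mat_carrier: "casorati_mat y m \<in> carrier_mat m m"
  by (simp add: casorati_mat_def)

lemma bordered_mat_carrier: "bordered_mat y m \<in> carrier_mat (Suc m) (Suc m)"
  by (simp add: bordered_mat_def)

text \<open>
  The expansion of a determinant with two equal rows.
\<close>

lemma border_cof_annihilates:
  assumes "h < m"
  shows "(\<Sum>j\<le>m. poly (border_cof y m j) x * poly (y h) (x - real j)) = 0"
proof -
  have "(\<Sum>j<Suc m. bordered_mat y m $$ (Suc h, j) * cofactor (bordered_mat y m) 0 j) = 0"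
    by (rule cofactor_row_orthogonal[OF bordered_mat_carrier]) (use assms in auto)
  moreover have "bordered_mat y m $$ (Suc h, j) = shift_poly (- real j) (y h)" if "j < Suc m" for j
    using that assms by (simp add: bordered_mat_def)
  ultimately have "(\<Sum>j<Suc m. shift_poly (- real j) (y h) * border_cof y m j) = 0"
    by (simp add: border_cof_def)
  from arg_cong[OF this, of "\<lambda>p. poly p x"] show ?thesis
    by (simp add: poly_sum poly_shift_poly mult.commute lessThan_Suc_atMost del: sum.lessThan_Suc)
qed

lemma border_cof_0: "border_cof y m 0 = casoratian y m"
proof -
  have "mat_delete (bordered_mat y m) 0 0 = casorati_mat y m"
    by (rule eq_matI) (auto simp: mat_delete_def bordered_mat_def casorati_mat_def)
  then show ?thesis by (simp add: border_cof_def cofactor_def casoratian_def)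
qed

lemma shift_poly_comm_ring_hom: "comm_ring_hom (shift_poly l)"
  by unfold_locales simp_all

text \<open>
  Deleting the last column leaves the Casorati matrix at the argument \<open>x + 1\<close>.
\<close>

lemma border_cof_last: "border_cof y m m = (- 1) ^ m * shift_poly 1 (casoratian y m)"
proof -
  interpret comm_ring_hom "shift_poly 1" by (rule shift_poly_comm_ring_hom)
  have "mat_delete (bordered_mat y m) 0 m = map_mat (shift_poly 1) (casorati_mat y m)"
    by (rule eq_matI) (auto simp: mat_delete_def bordered_mat_def casorati_mat_def)
  then show ?thesis by (simp add: border_cof_def cofactor_def casoratian_def)
qed

lemma casorati_cofactor:
  assumes "r < m" "t < m"
  shows "(\<Sum>h<m. poly (cofactor (casorati_mat y m) h t) z * poly (y h) (z - real (Suc r))) =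
    (if r = t then poly (casoratian y m) z else 0)"
proof -
  have "(\<Sum>h<m. cofactor (casorati_mat y m) h t * casorati_mat y m $$ (h, r)) =
      (if r = t then casoratian y m else 0)"
    unfolding casoratian_def by (rule cofactor_col_orthogonal[OF casorati_mat_carrier assms])
  moreover have "(\<Sum>h<m. cofactor (casorati_mat y m) h t * casorati_mat y m $$ (h, r)) =
      (\<Sum>h<m. cofactor (casorati_mat y m) h t * shift_poly (- real (Suc r)) (y h))"
    using assms by (intro sum.cong) (auto simp: casorati_mat_def)
  ultimately show ?thesis
    by (auto dest!: arg_cong[of _ _ "\<lambda>p. poly p z"] simp: poly_sum poly_shift_poly simp del: of_nat_Suc)
qed

text \<open>
  The identity that makes the eigenvalue equation work.  Write \<open>v\<close> for the partial sum
  \<open>\<Sum>\<^bsub>j < s\<^esub> \<beta>\<^sub>j y(x - j)\<close>, a vector indexed by \<open>h\<close>.  The term of \<open>cofactor_sum\<close> with index \<open>t\<close> pairs \<open>v\<close> with the cofactors of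
  a column of a Casorati matrix, which annihilate all other columns of this matrix.  If \<open>t \<ge> s\<close>, then \<open>v\<close> is a
  combination of such other columns and the term is 0.  If \<open>t < s\<close>, then \<open>v\<close> is rewritten as
  \<open>- \<Sum>\<^bsub>j \<ge> s\<^esub> \<beta>\<^sub>j y(x - j)\<close>, since the complete sum is 0, and only \<open>j = s\<close> survives, with the Casoratian as its
  factor.  The Casoratians add up to the telescoping sum of \<open>P\<close>.
\<close>

lemma cofactor_sum_identity:
  fixes x :: real
  assumes P: "\<And>x. poly P x - poly P (x - 1) = poly (casoratian y m) x" and s: "1 \<le> s" "s \<le> m"
  shows "(\<Sum>h<m. poly (cofactor_sum y m h) (x - real s) *
      (\<Sum>j<s. poly (border_cof y m j) x * poly (y h) (x - real j))) =
    - poly (border_cof y m s) x * (poly P x - poly P (x - real s))"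
proof -
  define b where "b j = poly (border_cof y m j) x" for j
  define v where "v h = (\<Sum>j<s. b j * poly (y h) (x - real j))" for h
  define z where "z t = x - real s + real (Suc t)" for t
  let ?C = "\<lambda>h t. poly (cofactor (casorati_mat y m) h t) (z t)"
  have v': "v h = - (\<Sum>j=s..m. b j * poly (y h) (x - real j))" if "h < m" for h
  proof -
    have "{..m} = {..<s} \<union> {s..m}" using s by auto
    then have "(\<Sum>j\<le>m. b j * poly (y h) (x - real j)) = v h + (\<Sum>j=s..m. b j * poly (y h) (x - real j))"
      unfolding v_def by (simp add: sum.union_disjoint ivl_disj_int)
    then show ?thesis using border_cof_annihilates[OF that, of y x] by (simp add: b_def)
  qed
  have col: "(\<Sum>h<m. ?C h t * poly (y h) (x - real j)) =
      (if j = s then poly (casoratian y m) (z t) else 0)"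
    if "t < m" "s \<le> t + j" "t + j - s < m" for t j
  proof -
    \<comment> \<open>The vector y(x - j) is column t + j - s of the Casorati matrix at z t.\<close>
    have x: "x - real j = z t - real (Suc (t + j - s))"
      using that by (simp add: z_def of_nat_diff)
    show ?thesis unfolding x casorati_cofactor[OF that(3,1)] using that by auto
  qed
  have St: "(\<Sum>h<m. ?C h t * v h) = (if t < s then - b s * poly (casoratian y m) (z t) else 0)"
    if t: "t < m" for t
  proof (cases "t < s")
    case True
    have "(\<Sum>h<m. ?C h t * v h) = (\<Sum>h<m. \<Sum>j=s..m. - (b j * (?C h t * poly (y h) (x - real j))))"
      by (intro sum.cong) (auto simp: v' sum_distrib_left sum_negf mult_ac)
    also have "\<dots> = (\<Sum>j=s..m. - b j * (\<Sum>h<m. ?C h t * poly (y h) (x - real j)))"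
      by (subst sum.swap) (simp add: sum_distrib_left sum_negf)
    also have "\<dots> = (\<Sum>j=s..m. if j = s then - b s * poly (casoratian y m) (z t) else 0)"
    proof (rule sum.cong)
      fix j assume "j \<in> {s..m}"
      with True t have "s \<le> t + j" "t + j - s < m" by auto
      from col[OF t this] show "- b j * (\<Sum>h<m. ?C h t * poly (y h) (x - real j)) =
          (if j = s then - b s * poly (casoratian y m) (z t) else 0)" by simp
    qed simp
    also have "\<dots> = - b s * poly (casoratian y m) (z t)" using s by simp
    finally show ?thesis using True by simp
  next
    case False
    have "(\<Sum>h<m. ?C h t * v h) = (\<Sum>h<m. \<Sum>j<s. b j * (?C h t * poly (y h) (x - real j)))"
      by (simp add: v_def sum_distrib_left mult_ac)
    also have "\<dots> = (\<Sum>j<s. b j * (\<Sum>h<m. ?C h t * poly (y h) (x - real j)))"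
      by (subst sum.swap) (simp add: sum_distrib_left)
    also have "\<dots> = 0"
    proof (rule sum.neutral, rule ballI)
      fix j assume "j \<in> {..<s}"
      with False t have "s \<le> t + j" "t + j - s < m" "j \<noteq> s" by auto
      with col[OF t this(1,2)] show "b j * (\<Sum>h<m. ?C h t * poly (y h) (x - real j)) = 0" by simp
    qed
    finally show ?thesis using False by simp
  qed
  have "(\<Sum>h<m. poly (cofactor_sum y m h) (x - real s) * v h) = (\<Sum>h<m. \<Sum>t<m. ?C h t * v h)"
    by (simp add: cofactor_sum_def poly_sum poly_shift_poly z_def sum_distrib_right del: of_nat_Suc)
  also have "\<dots> = (\<Sum>t<m. \<Sum>h<m. ?C h t * v h)" by (rule sum.swap)
  also have "\<dots> = (\<Sum>t<m. if t < s then - b s * poly (casoratian y m) (z t) else 0)"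
    by (intro sum.cong) (auto simp: St)
  also have "\<dots> = (\<Sum>t<s. - b s * poly (casoratian y m) (z t))"
    using s by (intro sum.mono_neutral_cong_right) auto
  also have "\<dots> = - b s * (\<Sum>t<s. poly P (x - real s + real (Suc t)) - poly P (x - real s + real t))"
    unfolding sum_distrib_left
  proof (rule sum.cong)
    fix t
    have "z t - 1 = x - real s + real t" "x - real s + real (Suc t) = z t" by (simp_all add: z_def)
    then show "- b s * poly (casoratian y m) (z t) =
        - b s * (poly P (x - real s + real (Suc t)) - poly P (x - real s + real t))"
      by (simp only: P[of "z t", symmetric])
  qed simp
  also have "(\<Sum>t<s. poly P (x - real s + real (Suc t)) - poly P (x - real s + real t)) =
      poly P x - poly P (x - real s)"
    by (subst sum_lessThan_telescope) simp
  finally show ?thesis by (simp add: v_def b_def)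
qed

section \<open>The eigenvalue equation\<close>

text \<open>
  This operator maps \<open>c\<^sub>n\<close> to the determinant \<open>q\<^sub>n\<close>: the cofactors, being polynomials in \<open>n\<close>, are
  realized as polynomials in the Charlier operator.
\<close>

definition intertwiner :: "real \<Rightarrow> (nat \<Rightarrow> real poly) \<Rightarrow> nat \<Rightarrow> int \<Rightarrow> real poly" where
  "intertwiner a y m l = (\<Sum>j\<le>m. smult ((- 1) ^ j)
     (dmul (dpow fwd_op j) (dpoly (charlier_op a) (border_cof y m j)) l))"

text \<open>
  With \<open>H\<close> the Charlier operator, this is \<open>P(H) + \<Sum>\<^sub>h M\<^sub>h(H) \<nabla> y\<^sub>h(H)\<close>, where \<open>M\<^sub>h\<close> is \<open>cofactor_sum\<close>.
\<close>

definition eigen_op :: "real \<Rightarrow> (nat \<Rightarrow> real poly) \<Rightarrow> nat \<Rightarrow> real poly \<Rightarrow> int \<Rightarrow> real poly" where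
  "eigen_op a y m P l = dpoly (charlier_op a) P l +
     (\<Sum>h<m. dmul (dpoly (charlier_op a) (cofactor_sum y m h))
        (dmul bwd_op (dpoly (charlier_op a) (y h))) l)"

text \<open>
  The determinant \<open>q\<^sub>n\<close>, expanded along its first row, for arbitrary polynomials \<open>y\<^sub>l\<close>.
\<close>

definition bordered_charlier :: "real \<Rightarrow> (nat \<Rightarrow> real poly) \<Rightarrow> nat \<Rightarrow> int \<Rightarrow> real poly" where
  "bordered_charlier a y m n =
     (\<Sum>j\<le>m. smult ((- 1) ^ j * poly (border_cof y m j) (of_int n)) (charlier a (n - int j)))"

lemmas fin_supps = fin_supp_dmul fin_supp_dpow fin_supp_dpoly fin_supp_charlier_op
  fin_supp_fwd_op fin_supp_bwd_op fin_supp_smult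

lemma dop_dpoly_charlier:
  "dop (dpoly (charlier_op a) P) (charlier a n) = smult (poly P (of_int n)) (charlier a n)"
  by (rule dop_dpoly_eigen[OF fin_supp_charlier_op dop_charlier_op])

lemma fin_supp_intertwiner: "fin_supp (intertwiner a y m)"
  unfolding intertwiner_def by (intro fin_supp_sum fin_supps) auto

lemma fin_supp_eigen_op: "fin_supp (eigen_op a y m P)"
  unfolding eigen_op_def by (intro fin_supp_add fin_supp_sum fin_supps) auto

lemma dop_intertwiner_charlier: "dop (intertwiner a y m) (charlier a n) = bordered_charlier a y m n"
  unfolding intertwiner_def bordered_charlier_def
  by (subst dop_sum) (simp_all add: fin_supps dop_smult dop_dmul dop_dpoly_charlier dop_linear dop_fwd_op_pow mult.commute)

lemma dop_eigen_op:
  "dop (eigen_op a y m P) p = dop (dpoly (charlier_op a) P) p +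
     (\<Sum>h<m. dop (dpoly (charlier_op a) (cofactor_sum y m h)) (dop bwd_op (dop (dpoly (charlier_op a) (y h)) p)))"
  unfolding eigen_op_def
  by (subst dop_add; (subst dop_sum)?) (simp_all add: fin_supps fin_supp_sum dop_dmul)

lemma bwd_reindexed:
  assumes "j \<le> L" "n \<le> int L"
  shows "dop bwd_op (charlier a (n - int j)) =
    (\<Sum>s\<in>{j<..L}. smult (- ((- 1) ^ (s + j))) (charlier a (n - int s)))"
proof -
  have "dop bwd_op (charlier a (n - int j)) =
      (\<Sum>i=1..L - j. smult (- ((- 1) ^ i)) (charlier a (n - int j - int i)))"
    by (rule dop_bwd_op_charlier) (use assms in auto)
  also have "\<dots> = (\<Sum>s\<in>{j<..L}. smult (- ((- 1) ^ (s + j))) (charlier a (n - int s)))"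
    by (rule sum.reindex_bij_witness[of _ "\<lambda>s. s - j" "\<lambda>i. i + j"])
      (use assms in \<open>auto simp: algebra_simps of_nat_diff power_add simp flip: power_mult_distrib\<close>)
  finally show ?thesis .
qed

text \<open>
  Apply the operator to \<open>q\<^sub>n = \<Sum>\<^sub>j (-1)\<^bsup>j\<^esup> \<beta>\<^sub>j(n) c\<^bsub>n - j\<^esub>\<close> and collect the coefficient of \<open>c\<^bsub>n - s\<^esub>\<close>.  Since \<open>\<nabla>\<close> spreads
  \<open>c\<^bsub>n - j\<^esub>\<close> over all smaller indices, the correction terms contribute the partial sums of
  \<open>cofactor_sum_identity\<close>, up to a sign, hence \<open>(-1)\<^bsup>s\<^esup> \<beta>\<^sub>s(n) (P(n) - P(n - s))\<close>; they vanish for \<open>s > m\<close>, where the partial sum is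
  complete.  The summand \<open>P(H)\<close> contributes \<open>(-1)\<^bsup>s\<^esup> \<beta>\<^sub>s(n) P(n - s)\<close>, and the sum is \<open>P(n) (-1)\<^bsup>s\<^esup> \<beta>\<^sub>s(n)\<close>.
\<close>

lemma eigen_op_bordered_charlier:
  assumes P: "\<And>x. poly P x - poly P (x - 1) = poly (casoratian y m) x"
  shows "dop (eigen_op a y m P) (bordered_charlier a y m n) =
    smult (poly P (of_int n)) (bordered_charlier a y m n)"
proof -
  \<comment> \<open>At least n, where the Charlier polynomials end, and at least m, the last index in q.\<close>
  define L where "L = max m (nat n)"
  have L: "m \<le> L" "n \<le> int L" by (auto simp: L_def)
  define X where "X = real_of_int n"
  define b where "b j = poly (border_cof y m j) X" for j
  define M where "M h s = poly (cofactor_sum y m h) (X - real s)" for h and s :: nat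
  define Y where "Y h j = poly (y h) (X - real j)" for h and j :: nat
  define c where "c s = charlier a (n - int s)" for s
  define w where "w s = (\<Sum>h<m. M h s * (\<Sum>j\<le>m. if j < s then b j * Y h j else 0))" for s
  have w: "w s = (if s \<le> m then - b s * (poly P X - poly P (X - real s)) else 0)" if "s \<in> {1..L}" for s
  proof (cases "s \<le> m")
    case True
    then have "(\<Sum>j\<le>m. if j < s then b j * Y h j else 0) = (\<Sum>j<s. b j * Y h j)" for h
      by (intro sum.mono_neutral_cong_right) auto
    then show ?thesis
      using cofactor_sum_identity[OF P, of s X] True that by (simp add: w_def b_def M_def Y_def)
  next
    case False
    then have "(\<Sum>j\<le>m. if j < s then b j * Y h j else 0) = (\<Sum>j\<le>m. b j * Y h j)" for h
      by (intro sum.cong) auto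
    then show ?thesis
      using border_cof_annihilates[of _ m y X] False by (simp add: w_def b_def Y_def)
  qed
  have q: "bordered_charlier a y m n = (\<Sum>j\<le>m. smult ((- 1) ^ j * b j) (c j))"
    by (simp add: bordered_charlier_def b_def c_def X_def)
  have poly_op: "dop (dpoly (charlier_op a) Q) (c j) = smult (poly Q (X - real j)) (c j)" for Q j
    by (simp add: c_def dop_dpoly_charlier X_def)
  have bwd: "dop bwd_op (c j) = (\<Sum>s\<in>{j<..L}. smult (- ((- 1) ^ (s + j))) (c s))" if "j \<le> m" for j
    unfolding c_def by (rule bwd_reindexed) (use that L in auto)
  have J: "dop (dpoly (charlier_op a) (cofactor_sum y m h)) (dop bwd_op (dop (dpoly (charlier_op a) (y h))
      (bordered_charlier a y m n))) =
      (\<Sum>j\<le>m. \<Sum>s\<in>{j<..L}. smult (- ((- 1) ^ s) * (M h s * (b j * Y h j))) (c s))" for h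
  proof -
    have "dop (dpoly (charlier_op a) (cofactor_sum y m h)) (dop bwd_op (dop (dpoly (charlier_op a) (y h))
      (bordered_charlier a y m n))) = (\<Sum>j\<le>m. \<Sum>s\<in>{j<..L}.
        smult ((- 1) ^ j * b j * Y h j * (- ((- 1) ^ (s + j))) * M h s) (c s))"
      unfolding q by (simp add: dop_sum_right dop_linear poly_op bwd smult_sum_right M_def Y_def mult_ac
          del: smult_minus_left cong: sum.cong_simp)
    also have "\<dots> = (\<Sum>j\<le>m. \<Sum>s\<in>{j<..L}. smult (- ((- 1) ^ s) * (M h s * (b j * Y h j))) (c s))"
    proof (intro sum.cong refl)
      fix s j :: nat
      have "(- 1) ^ j * ((- 1) ^ (s + j)) = ((- 1) ^ s :: real)"
        by (simp add: power_add mult.left_commute flip: power_mult_distrib)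
      then have "(- 1) ^ j * b j * Y h j * (- ((- 1) ^ (s + j))) * M h s =
          - ((- 1) ^ s) * (M h s * (b j * Y h j))"
        by (simp add: algebra_simps)
      then show "smult ((- 1) ^ j * b j * Y h j * (- ((- 1) ^ (s + j))) * M h s) (c s) =
          smult (- ((- 1) ^ s) * (M h s * (b j * Y h j))) (c s)" by (simp only:)
    qed
    finally show ?thesis .
  qed
  have "(\<Sum>h<m. dop (dpoly (charlier_op a) (cofactor_sum y m h)) (dop bwd_op (dop (dpoly (charlier_op a) (y h))
      (bordered_charlier a y m n)))) =
      (\<Sum>h<m. \<Sum>j\<le>m. \<Sum>s\<in>{1..L}. smult (if j < s then - ((- 1) ^ s) * (M h s * (b j * Y h j)) else 0) (c s))"
    unfolding J by (intro sum.cong refl sum.mono_neutral_cong_left) auto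
  also have "\<dots> = (\<Sum>h<m. \<Sum>s\<in>{1..L}. \<Sum>j\<le>m. smult (if j < s then - ((- 1) ^ s) * (M h s * (b j * Y h j)) else 0) (c s))"
    by (intro sum.cong refl sum.swap)
  also have "\<dots> = (\<Sum>s\<in>{1..L}. \<Sum>h<m. \<Sum>j\<le>m. smult (if j < s then - ((- 1) ^ s) * (M h s * (b j * Y h j)) else 0) (c s))"
    by (rule sum.swap)
  also have "\<dots> = (\<Sum>s\<in>{1..L}. smult (- ((- 1) ^ s) * w s) (c s))"
  proof (rule sum.cong)
    fix s
    have "- ((- 1) ^ s) * w s = (\<Sum>h<m. \<Sum>j\<le>m. if j < s then - ((- 1) ^ s) * (M h s * (b j * Y h j)) else 0)"
      unfolding w_def sum_distrib_left by (intro sum.cong refl) simp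
    then show "(\<Sum>h<m. \<Sum>j\<le>m. smult (if j < s then - ((- 1) ^ s) * (M h s * (b j * Y h j)) else 0) (c s)) =
        smult (- ((- 1) ^ s) * w s) (c s)"
      by (simp only: smult_sum)
  qed simp
  also have "\<dots> = (\<Sum>s\<le>m. smult ((- 1) ^ s * b s * (poly P X - poly P (X - real s))) (c s))"
    using L by (intro sum.mono_neutral_cong) (auto simp: w mult.assoc Suc_le_eq)
  finally have JJ: "(\<Sum>h<m. dop (dpoly (charlier_op a) (cofactor_sum y m h)) (dop bwd_op (dop (dpoly (charlier_op a) (y h))
      (bordered_charlier a y m n)))) = (\<Sum>s\<le>m. smult ((- 1) ^ s * b s * (poly P X - poly P (X - real s))) (c s))" .
  have "dop (dpoly (charlier_op a) P) (bordered_charlier a y m n) =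
      (\<Sum>s\<le>m. smult ((- 1) ^ s * b s * poly P (X - real s)) (c s))"
    unfolding q by (simp add: dop_sum_right dop_linear poly_op mult_ac)
  then have "dop (eigen_op a y m P) (bordered_charlier a y m n) =
      (\<Sum>s\<le>m. smult ((- 1) ^ s * b s * poly P (X - real s)) (c s) +
        smult ((- 1) ^ s * b s * (poly P X - poly P (X - real s))) (c s))"
    unfolding dop_eigen_op JJ sum.distrib by (simp only:)
  also have "\<dots> = (\<Sum>s\<le>m. smult ((- 1) ^ s * b s * poly P X) (c s))"
    by (intro sum.cong refl) (simp only: smult_add_left[symmetric] distrib_left[symmetric] diff_add_cancel add_diff_cancel_left' add_diff_eq)
  also have "\<dots> = smult (poly P (of_int n)) (bordered_charlier a y m n)"
    unfolding q by (simp add: smult_sum_right mult_ac X_def)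
  finally show ?thesis .
qed

text \<open>
  The single summands \<open>M\<^sub>h(H) \<nabla> y\<^sub>h(H)\<close> can have larger order than \<open>P(H)\<close>, and their highest and lowest
  coefficients then cancel in the sum.  This is not visible from the formula, but it follows from the
  intertwining relation \<open>D B = B P(H)\<close>, where \<open>B\<close> maps \<open>c\<^sub>n\<close> to \<open>q\<^sub>n\<close>: the lowest and highest shifts add up on both
  sides, and \<open>B\<close> cancels.
\<close>

lemma spans_eigen_op:
  assumes "a \<noteq> 0" and "P \<noteq> 0"
    and P: "\<And>x. poly P x - poly P (x - 1) = poly (casoratian y m) x"
    and q: "\<And>n. bordered_charlier a y m (int n) \<noteq> 0"
  shows "spans (eigen_op a y m P) (- int (degree P)) (int (degree P))"
proof -
  let ?D = "eigen_op a y m P" and ?B = "intertwiner a y m" and ?C = "dpoly (charlier_op a) P"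
  have fin: "fin_supp ?D" "fin_supp ?B" "fin_supp ?C"
    by (intro fin_supp_eigen_op fin_supp_intertwiner fin_supps)+
  have eq_c: "dop (dmul ?D ?B) (charlier a (int n)) = dop (dmul ?B ?C) (charlier a (int n))" for n
    by (simp add: dop_dmul fin dop_intertwiner_charlier eigen_op_bordered_charlier[OF P] dop_dpoly_charlier dop_linear)
  have "dop (dmul ?D ?B) p = dop (dmul ?B ?C) p" for p
  proof -
    obtain \<alpha> where "p = (\<Sum>i\<le>degree p. smult (\<alpha> i) (charlier a (int i)))"
      using charlier_basis[of p "degree p" a] by blast
    then show ?thesis
      by (metis (mono_tags, lifting) dop_linear(3) dop_sum_right eq_c sum.cong)
  qed
  then have DB: "dmul ?D ?B = dmul ?B ?C"
    by (intro dop_inject fin_supps fin)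
  \<comment> \<open>A nonzero eigenvalue shows that the operator is nonzero, so that its extreme shifts exist.\<close>
  obtain n :: nat where n: "poly P (real n) \<noteq> 0"
  proof -
    have "finite {x. poly P x = 0}" by (rule poly_roots_finite[OF assms(2)])
    then have "finite (real ` {n. poly P (real n) = 0})" by (rule finite_subset[rotated]) auto
    then have "finite {n. poly P (real n) = 0}" by (rule finite_imageD) (auto simp: inj_on_def)
    then have "{n. poly P (real n) = 0} \<noteq> UNIV" by (metis infinite_UNIV_nat)
    then show ?thesis using that by auto
  qed
  have "\<exists>l. ?B l \<noteq> 0"
  proof (rule ccontr)
    assume "\<not> ?thesis"
    then have "dop ?B (charlier a (int 0)) = 0" by (simp add: dop_def)
    then show False using q[of 0] by (simp only: dop_intertwiner_charlier)
  qed
  then obtain s r where B: "spans ?B s r" by (metis spans_exists fin(2))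
  have "\<exists>l. ?D l \<noteq> 0"
  proof (rule ccontr)
    assume "\<not> ?thesis"
    then have "dop ?D (bordered_charlier a y m (int n)) = 0" by (simp add: dop_def)
    then show False using q[of n] n by (simp add: eigen_op_bordered_charlier[OF P])
  qed
  then obtain s' r' where D: "spans ?D s' r'" by (metis spans_exists fin(1))
  have "spans ?C (- int (degree P)) (int (degree P))"
    by (intro spans_dpoly spans_charlier_op assms)
  from spans_dmul[OF B this] spans_dmul[OF D B]
  have "s' = - int (degree P) \<and> r' = int (degree P)"
    unfolding DB using spans_unique by fastforce
  with D show ?thesis by simp
qed

section \<open>The degree of the Casoratian\<close>

lemma coeff_mult_bounds:
  assumes "degree p \<le> i" and "degree q \<le> j"
  shows "coeff (p * q) (i + j) = coeff p i * coeff q j"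
proof -
  have "coeff (p * q) (i + j) = (\<Sum>k\<le>i + j. coeff p k * coeff q (i + j - k))" by (rule coeff_mult)
  also have "\<dots> = (\<Sum>k\<in>{i}. coeff p k * coeff q (i + j - k))"
  proof (rule sum.mono_neutral_right)
    show "\<forall>k\<in>{..i + j} - {i}. coeff p k * coeff q (i + j - k) = 0"
    proof
      fix k assume "k \<in> {..i + j} - {i}"
      then have "k > i \<or> i + j - k > j" by auto
      then show "coeff p k * coeff q (i + j - k) = 0"
        using assms by (auto simp: coeff_eq_0)
    qed
  qed auto
  finally show ?thesis by simp
qed

lemma prod_degree_coeff:
  assumes "finite A" and "\<And>i. i \<in> A \<Longrightarrow> degree (f i) \<le> e i"
  shows "degree (\<Prod>i\<in>A. f i) \<le> (\<Sum>i\<in>A. e i) \<and>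
    coeff (\<Prod>i\<in>A. f i) (\<Sum>i\<in>A. e i) = (\<Prod>i\<in>A. coeff (f i) (e i))"
  using assms
proof (induction A rule: finite_induct)
  case (insert i A)
  then have "degree (f i) \<le> e i" "degree (\<Prod>i\<in>A. f i) \<le> (\<Sum>i\<in>A. e i)" by auto
  then show ?case using insert coeff_mult_bounds[of "f i" "e i" "\<Prod>i\<in>A. f i" "\<Sum>i\<in>A. e i"]
    by (auto intro: order.trans[OF degree_mult_le add_mono])
qed simp

text \<open>
  If the degree of an entry is at most a number \<open>d\<^sub>i\<close> of its row minus the column index, every term of the Leibniz formula has
  the same degree bound, and the coefficient of that degree is the determinant of the coefficients.
\<close>

lemma det_degree_coeff:
  fixes A :: "real poly mat" and d :: "nat \<Rightarrow> nat"
  assumes A: "A \<in> carrier_mat m m"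
    and deg: "\<And>i j. \<lbrakk>i < m; j < m; j \<le> d i\<rbrakk> \<Longrightarrow> degree (A $$ (i, j)) \<le> d i - j"
    and zero: "\<And>i j. \<lbrakk>i < m; j < m; d i < j\<rbrakk> \<Longrightarrow> A $$ (i, j) = 0"
  defines "D \<equiv> (\<Sum>i<m. d i) - (\<Sum>i<m. i)"
  shows "degree (det A) \<le> D"
    and "coeff (det A) D = det (mat m m (\<lambda>(i, j). if j \<le> d i then coeff (A $$ (i, j)) (d i - j) else 0))"
proof -
  let ?c = "\<lambda>i j. if j \<le> d i then coeff (A $$ (i, j)) (d i - j) else 0"
  have *: "degree (\<Prod>i<m. A $$ (i, p i)) \<le> D \<and> coeff (\<Prod>i<m. A $$ (i, p i)) D = (\<Prod>i<m. ?c i (p i))"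
    if p: "p permutes {0..<m}" for p
  \<comment> \<open>Natural subtraction truncates, so terms with an entry right of the staircase are treated apart; they are 0.\<close>
  proof (cases "\<forall>i<m. p i \<le> d i")
    case True
    have lt: "p i < m" if "i < m" for i using permutes_in_image[OF p, of i] that by simp
    have "(\<Sum>i<m. p i) = (\<Sum>i<m. i)"
      using sum.permute[OF p, of "\<lambda>i. i"] by (simp add: atLeast0LessThan)
    then have D: "D = (\<Sum>i<m. d i - p i)"
      using True unfolding D_def by (subst sum_subtractf_nat) auto
    show ?thesis unfolding D
      using prod_degree_coeff[of "{..<m}" "\<lambda>i. A $$ (i, p i)" "\<lambda>i. d i - p i"] True lt deg by auto
  next
    case False
    then obtain i where i: "i < m" "d i < p i" by auto
    have "p i < m" using permutes_in_image[OF p, of i] i by simp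
    with i zero have "(\<Prod>i<m. A $$ (i, p i)) = 0" by (intro prod_zero) auto
    moreover have "(\<Prod>i<m. ?c i (p i)) = 0"
      using i by (intro prod_zero bexI[of _ i]) auto
    ultimately show ?thesis by (simp only: degree_0 coeff_0 le0)
  qed
  have sgn: "degree (signof p * q) = degree q" "coeff (signof p * q) k = signof p * coeff q k"
    for p and q :: "real poly" and k
    by (auto simp: sign_def)
  have detA: "det A = (\<Sum>p | p permutes {0..<m}. signof p * (\<Prod>i<m. A $$ (i, p i)))"
    using det_def'[OF A] by (simp add: atLeast0LessThan)
  show "degree (det A) \<le> D"
    unfolding detA by (rule degree_sum_le) (use * in \<open>auto simp: sgn finite_permutations\<close>)
  have "coeff (det A) D = (\<Sum>p | p permutes {0..<m}. signof p * (\<Prod>i<m. ?c i (p i)))"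
    unfolding detA coeff_sum by (intro sum.cong) (use * in \<open>auto simp: sgn\<close>)
  also have "\<dots> = det (mat m m (\<lambda>(i, j). ?c i j))"
  proof -
    have "(\<Prod>i<m. ?c i (p i)) = (\<Prod>i = 0..<m. mat m m (\<lambda>(i, j). ?c i j) $$ (i, p i))"
      if p: "p permutes {0..<m}" for p
      unfolding atLeast0LessThan
      by (intro prod.cong refl) (use permutes_in_image[OF p] in auto)
    then show ?thesis by (subst det_def'[of _ m]) (auto intro!: sum.cong)
  qed
  finally show "coeff (det A) D = det (mat m m (\<lambda>(i, j). ?c i j))" .
qed

text \<open>
  Scaling row \<open>i\<close> by \<open>g\<^sub>i!\<close> turns the entries into falling factorials \<open>j! binom(g\<^sub>i, j)\<close>, a Vandermonde matrix in
  another basis.  A vector in the kernel gives a polynomial of degree less than \<open>m\<close> with the \<open>m\<close> roots \<open>g\<^sub>i\<close>.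
\<close>

lemma det_inverse_factorials_nonzero:
  fixes g :: "nat \<Rightarrow> nat"
  assumes inj: "inj_on g {..<m}"
  shows "det (mat m m (\<lambda>(i, j). if j \<le> g i then 1 / fact (g i - j) else 0 :: real)) \<noteq> 0"
proof
  let ?A = "mat m m (\<lambda>(i, j). if j \<le> g i then 1 / fact (g i - j) else 0 :: real)"
  assume "det ?A = 0"
  then obtain v where v: "v \<in> carrier_vec m" "v \<noteq> 0\<^sub>v m" "?A *\<^sub>v v = 0\<^sub>v m"
    using det_0_iff_vec_prod_zero[of ?A m] by auto
  define Q where "Q = (\<Sum>j<m. smult (fact j * v $ j) (binom_poly j))"
  have Q: "poly Q (real k) = (\<Sum>j<m. fact j * v $ j * real (k choose j))" for k
    by (simp add: Q_def poly_sum poly_binom_poly binomial_gbinomial)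
  have root: "poly Q (real (g i)) = 0" if "i < m" for i
  proof -
    have "0 = fact (g i) * (?A *\<^sub>v v) $ i" using v that by simp
    also have "\<dots> = (\<Sum>j<m. fact (g i) * ((if j \<le> g i then 1 / fact (g i - j) else 0) * v $ j))"
      using v(1) that by (simp add: scalar_prod_def sum_distrib_left atLeast0LessThan)
    also have "\<dots> = poly Q (real (g i))"
      unfolding Q by (intro sum.cong refl) (auto simp: binomial_fact)
    finally show ?thesis ..
  qed
  have "Q = 0"
  proof (cases "m = 0")
    case False
    show ?thesis
    proof (rule poly_eqI_degree[of "(\<lambda>i. real (g i)) ` {..<m}"])
      have "card ((\<lambda>i. real (g i)) ` {..<m}) = m"
        using inj by (subst card_image) (auto simp: inj_on_def)
      moreover have "degree Q \<le> m - 1" unfolding Q_def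
        by (rule degree_sum_le) (auto intro!: order.trans[OF degree_smult_le] order.trans[OF degree_binom_poly_le])
      ultimately show "degree Q < card ((\<lambda>i. real (g i)) ` {..<m})"
        "degree 0 < card ((\<lambda>i. real (g i)) ` {..<m})" using False by auto
    qed (use root in auto)
  qed (simp add: Q_def)
  have "v $ k = 0" if "k < m" for k
    using that
  proof (induction k rule: less_induct)
    case (less k)
    have "(\<Sum>j<m. fact j * v $ j * real (k choose j)) = (\<Sum>j\<in>{k}. fact j * v $ j * real (k choose j))"
    proof (rule sum.mono_neutral_right)
      show "\<forall>j\<in>{..<m} - {k}. fact j * v $ j * real (k choose j) = 0"
      proof
        fix j assume "j \<in> {..<m} - {k}"
        then show "fact j * v $ j * real (k choose j) = 0"
          using less.IH[of j] by (cases "j < k") auto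
      qed
    qed (use less.prems in auto)
    with Q[of k] \<open>Q = 0\<close> show ?case by simp
  qed
  then have "v = 0\<^sub>v m" using v(1) by (intro eq_vecI) auto
  with v(2) show False by blast
qed

text \<open>
  The row functions \<open>n \<mapsto> c\<^sub>g(- n - 1)\<close> of the determinant \<open>q\<^sub>n\<close>, with parameter \<open>- a\<close>, as polynomials in \<open>n\<close>.
\<close>

definition dual_charlier :: "real \<Rightarrow> nat set \<Rightarrow> nat \<Rightarrow> real poly" where
  "dual_charlier a G l = pcompose (charlier (- a) (int (sorted_list_of_set G ! l))) [:- 1, - 1:]"

lemma poly_dual_charlier:
  "poly (dual_charlier a G l) x = poly (charlier (- a) (int (sorted_list_of_set G ! l))) (- x - 1)"
proof -
  have "poly [:- 1, - 1:] x = - x - 1" by simp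
  then show ?thesis by (simp only: dual_charlier_def poly_pcompose)
qed

lemma charlier_shift_nat:
  "poly (charlier a n) (x + real r) = (\<Sum>i\<le>r. real (r choose i) * poly (charlier a (n - int i)) x)"
proof (induction r arbitrary: n)
  case (Suc r)
  have "poly (charlier a n) (x + real (Suc r)) =
      poly (charlier a n) (x + real r) + poly (charlier a (n - 1)) (x + real r)"
    using charlier_difference[of a n "x + real r"] by (simp add: add_ac)
  also have "\<dots> = (\<Sum>i\<le>Suc r. real (r choose i) * poly (charlier a (n - int i)) x) +
      (\<Sum>i\<le>r. real (r choose i) * poly (charlier a (n - 1 - int i)) x)"
    by (simp add: Suc.IH)
  also have "\<dots> = (\<Sum>i\<le>Suc r. real (Suc r choose i) * poly (charlier a (n - int i)) x)"
    by (subst (1 2) sum.atMost_Suc_shift) (simp add: sum.distrib algebra_simps)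
  finally show ?case .
qed simp

text \<open>
  Expanding \<open>c\<^sub>g(x + r)\<close> into \<open>\<Sum>\<^sub>i binom(r, i) c\<^bsub>g - i\<^esub>(x)\<close> factors the Casorati matrix into \<open>(c\<^bsub>g - i\<^esub>)\<close> and a unipotent
  triangular matrix.  The degrees in the first factor are \<open>g - i\<close>, with leading coefficients \<open>1 / (g - i)!\<close>.
\<close>

lemma degree_casoratian_dual_charlier:
  assumes "finite G"
  defines "m \<equiv> card G"
  shows "casoratian (dual_charlier a G) m \<noteq> 0"
    and "degree (casoratian (dual_charlier a G) m) = \<Sum>G - (\<Sum>i<m. i)"
proof -
  define g where "g l = sorted_list_of_set G ! l" for l
  define V where "V = mat m m (\<lambda>(l, i). charlier (- a) (int (g l) - int i))"
  define U :: "real poly mat" where "U = mat m m (\<lambda>(i, r). [:real (r choose i):])"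
  have len: "length (sorted_list_of_set G) = m" using assms by simp
  have inj: "inj_on g {..<m}"
    using assms len by (auto simp: inj_on_def g_def nth_eq_iff_index_eq)
  have sumg: "(\<Sum>l<m. g l) = \<Sum>G"
  proof -
    have "bij_betw g {..<m} G"
      unfolding g_def using bij_betw_nth[of "sorted_list_of_set G" "{..<m}" G] assms len by simp
    then show ?thesis using sum.reindex_bij_betw[of g "{..<m}" G "\<lambda>x. x"] by simp
  qed
  have V: "V \<in> carrier_mat m m" and U: "U \<in> carrier_mat m m" by (simp_all add: V_def U_def)
  have detU: "det U = 1"
  proof -
    have "upper_triangular U" by (auto simp: upper_triangular_def U_def)
    then have "det U = prod_list (diag_mat U)" by (rule det_upper_triangular[OF _ U])
    also have "diag_mat U = map (\<lambda>_. 1) [0..<m]" by (auto simp: diag_mat_def U_def)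
    also have "prod_list (map (\<lambda>_. 1 :: real poly) xs) = 1" for xs :: "nat list"
      by (induction xs) auto
    finally show ?thesis .
  qed
  have "casoratian (dual_charlier a G) m = pcompose (det (V * U)) [:0, - 1:]"
  proof -
    interpret comm_ring_hom "\<lambda>p :: real poly. pcompose p [:0, - 1:]"
      by unfold_locales (auto simp: pcompose_add pcompose_mult pcompose_1)
    have "casorati_mat (dual_charlier a G) m = map_mat (\<lambda>p. pcompose p [:0, - 1:]) (V * U)"
    proof (rule eq_matI)
      fix l r assume "l < dim_row (map_mat (\<lambda>p. pcompose p [:0, - 1:]) (V * U))"
        "r < dim_col (map_mat (\<lambda>p. pcompose p [:0, - 1:]) (V * U))"
      then have lr: "l < m" "r < m" by (simp_all add: V_def U_def)
      have "(V * U) $$ (l, r) = (\<Sum>i<m. smult (real (r choose i)) (charlier (- a) (int (g l) - int i)))"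
        using lr by (simp add: V_def U_def scalar_prod_def atLeast0LessThan mult.commute)
      also have "\<dots> = (\<Sum>i\<le>r. smult (real (r choose i)) (charlier (- a) (int (g l) - int i)))"
        using lr by (intro sum.mono_neutral_right) auto
      finally have "(V * U) $$ (l, r) = \<dots>" .
      then have "poly ((V * U) $$ (l, r)) (- x) = poly (charlier (- a) (int (g l))) (- x + real r)" for x
        by (simp only: poly_sum poly_smult charlier_shift_nat)
      then have "shift_poly (- real (Suc r)) (dual_charlier a G l) = pcompose ((V * U) $$ (l, r)) [:0, - 1:]"
        by (intro poly_real_eqI) (simp add: poly_shift_poly poly_dual_charlier poly_pcompose g_def algebra_simps)
      then show "casorati_mat (dual_charlier a G) m $$ (l, r) = map_mat (\<lambda>p. pcompose p [:0, - 1:]) (V * U) $$ (l, r)"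
        using lr by (simp add: casorati_mat_def V_def U_def)
    qed (simp_all add: casorati_mat_def V_def U_def)
    then show ?thesis by (simp add: casoratian_def)
  qed
  then have cas: "casoratian (dual_charlier a G) m = pcompose (det V) [:0, - 1:]"
    by (simp add: det_mult[OF V U] detU)
  have VD: "degree (det V) \<le> (\<Sum>i<m. g i) - (\<Sum>i<m. i)"
    "coeff (det V) ((\<Sum>i<m. g i) - (\<Sum>i<m. i)) =
       det (mat m m (\<lambda>(i, j). if j \<le> g i then coeff (V $$ (i, j)) (g i - j) else 0))"
    by (rule det_degree_coeff[OF V]; auto simp: V_def of_nat_diff[symmetric] simp del: of_nat_diff)+
  have "mat m m (\<lambda>(i, j). if j \<le> g i then coeff (V $$ (i, j)) (g i - j) else 0) =
      mat m m (\<lambda>(i, j). if j \<le> g i then 1 / fact (g i - j) else 0)"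
    by (rule eq_matI) (auto simp: V_def coeff_charlier of_nat_diff[symmetric] simp del: of_nat_diff)
  with VD(2) det_inverse_factorials_nonzero[OF inj]
  have nz: "coeff (det V) ((\<Sum>i<m. g i) - (\<Sum>i<m. i)) \<noteq> 0" by simp
  then have degV: "degree (det V) = (\<Sum>i<m. g i) - (\<Sum>i<m. i)" using VD(1) le_degree by force
  show "casoratian (dual_charlier a G) m \<noteq> 0"
    unfolding cas using nz by (auto simp: pcompose_eq_0_iff)
  show "degree (casoratian (dual_charlier a G) m) = \<Sum>G - (\<Sum>i<m. i)"
    unfolding cas using degV by (simp add: degree_pcompose sumg)
qed

section \<open>The determinants as bordered Casoratians\<close>

lemma Omega_eq_casoratian:
  "Omega a G n = poly (casoratian (dual_charlier a G) (card G)) (real n)"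
proof -
  interpret comm_ring_hom "\<lambda>p. poly p (real n)" by unfold_locales auto
  have "mat (card G) (card G) (\<lambda>(i, j).
       poly (charlier (- a) (int (sorted_list_of_set G ! i))) (- real n + real j)) =
      map_mat (\<lambda>p. poly p (real n)) (casorati_mat (dual_charlier a G) (card G))"
    by (rule eq_matI) (auto simp: casorati_mat_def poly_shift_poly poly_dual_charlier algebra_simps)
  then show ?thesis by (simp add: Omega_def casoratian_def)
qed

lemma q_poly_eq_bordered_charlier:
  "q_poly a G n = bordered_charlier a (dual_charlier a G) (card G) (int n)"
proof -
  let ?m = "card G" and ?y = "dual_charlier a G"
  define A where "A = mat (?m + 1) (?m + 1) (\<lambda>(i, j).
       if i = 0 then (- 1) ^ j * charlier a (int n - int j)
       else [:poly (charlier (- a) (int (sorted_list_of_set G ! (i - 1)))) (- real n - 1 + real j):])"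
  interpret comm_ring_hom "\<lambda>p. [:poly p (real n):]" by unfold_locales (auto simp: one_pCons)
  have cof: "cofactor A 0 j = [:poly (border_cof ?y ?m j) (real n):]" if "j \<le> ?m" for j
  proof -
    have "mat_delete A 0 j = map_mat (\<lambda>p. [:poly p (real n):]) (mat_delete (bordered_mat ?y ?m) 0 j)"
      by (rule eq_matI) (use that in \<open>auto simp: A_def mat_delete_def bordered_mat_def poly_shift_poly
          poly_dual_charlier algebra_simps\<close>)
    then have "det (mat_delete A 0 j) = [:poly (det (mat_delete (bordered_mat ?y ?m) 0 j)) (real n):]"
      by simp
    then show ?thesis by (cases "even j") (simp_all add: cofactor_def border_cof_def)
  qed
  have "q_poly a G n = det A" by (simp add: q_poly_def A_def)
  also have "\<dots> = (\<Sum>j<?m + 1. A $$ (0, j) * cofactor A 0 j)"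
    by (rule laplace_expansion_row) (auto simp: A_def)
  also have "\<dots> = (\<Sum>j\<le>?m. smult ((- 1) ^ j * poly (border_cof ?y ?m j) (real n)) (charlier a (int n - int j)))"
  proof (rule sum.cong)
    fix j assume "j \<in> {..?m}"
    then have j: "j \<le> ?m" by simp
    have "A $$ (0, j) = smult ((- 1) ^ j) (charlier a (int n - int j))"
      using j by (cases "even j") (auto simp: A_def)
    then show "A $$ (0, j) * cofactor A 0 j =
        smult ((- 1) ^ j * poly (border_cof ?y ?m j) (real n)) (charlier a (int n - int j))"
      using cof[OF j] by (simp add: mult.commute)
  qed auto
  finally show ?thesis by (simp add: bordered_charlier_def)
qed

text \<open>
  Only the summand \<open>j = 0\<close> has degree \<open>n\<close>, and its coefficient is the Casoratian.
\<close>

lemma bordered_charlier_degree: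
  assumes "poly (casoratian y m) (real n) \<noteq> 0"
  shows "degree (bordered_charlier a y m (int n)) = n" and "bordered_charlier a y m (int n) \<noteq> 0"
proof -
  let ?q = "bordered_charlier a y m (int n)"
  have deg: "degree (charlier a (int n - int j)) \<le> n \<and> (j > 0 \<longrightarrow> coeff (charlier a (int n - int j)) n = 0)" for j
  proof (cases "j \<le> n")
    case True
    then have "int n - int j = int (n - j)" by simp
    then show ?thesis using True by (auto simp only: degree_charlier coeff_charlier_gt intro!: coeff_charlier_gt)
  qed auto
  have "degree ?q \<le> n"
    unfolding bordered_charlier_def
    by (rule degree_sum_le) (use deg in \<open>auto intro: order.trans[OF degree_smult_le]\<close>)
  have "coeff ?q n = (\<Sum>j\<le>m. if j = 0 then poly (border_cof y m 0) (real n) / fact n else 0)"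
    unfolding bordered_charlier_def coeff_sum
    by (intro sum.cong) (use deg in \<open>auto simp: coeff_charlier\<close>)
  also have "\<dots> = poly (casoratian y m) (real n) / fact n" by (simp add: border_cof_0)
  finally have "coeff ?q n \<noteq> 0" using assms by simp
  with \<open>degree ?q \<le> n\<close> show "degree ?q = n" using le_degree by force
  from \<open>coeff ?q n \<noteq> 0\<close> show "?q \<noteq> 0" by auto
qed

section \<open>Interpolation and divided differences\<close>

lemma lagrange_interpolation:
  fixes u :: "'i \<Rightarrow> real"
  assumes "finite I" and "inj_on u I" and "degree p < card I"
  shows "p = (\<Sum>i\<in>I. smult (poly p (u i) / (\<Prod>j\<in>I - {i}. u i - u j)) (\<Prod>j\<in>I - {i}. [:- u j, 1:]))"
    (is "p = ?L")
proof (rule poly_eqI_degree[of "u ` I"])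
  have card: "card (u ` I) = card I" by (rule card_image[OF assms(2)])
  then show "degree p < card (u ` I)" using assms by simp
  have "degree ?L \<le> card I - 1"
    by (rule degree_sum_le)
      (auto intro!: order.trans[OF degree_smult_le] simp: degree_prod_eq_sum_degree assms(1))
  then show "degree ?L < card (u ` I)" using assms card by linarith
  fix x assume "x \<in> u ` I"
  then obtain k where k: "k \<in> I" "x = u k" by blast
  have nz: "(\<Prod>j\<in>I - {k}. u k - u j) \<noteq> 0" using assms k by (auto dest: inj_onD)
  have "poly ?L x = (\<Sum>i\<in>I. poly p (u i) / (\<Prod>j\<in>I - {i}. u i - u j) * (\<Prod>j\<in>I - {i}. u k - u j))"
    by (simp add: poly_sum poly_prod k)
  also have "\<dots> = (\<Sum>i\<in>{k}. poly p (u i) / (\<Prod>j\<in>I - {i}. u i - u j) * (\<Prod>j\<in>I - {i}. u k - u j))"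
  proof (rule sum.mono_neutral_right[OF assms(1)])
    show "\<forall>i\<in>I - {k}. poly p (u i) / (\<Prod>j\<in>I - {i}. u i - u j) * (\<Prod>j\<in>I - {i}. u k - u j) = 0"
      using k assms(1) by auto
  qed (use k in auto)
  also have "\<dots> = poly p x" using nz k by simp
  finally show "poly p x = poly ?L x" ..
qed

text \<open>
  Compare the coefficients of degree \<open>card I - 1\<close> in Lagrange's formula.
\<close>

lemma divided_difference:
  fixes u :: "'i \<Rightarrow> real"
  assumes "finite I" and "inj_on u I" and "degree p < card I"
  shows "(\<Sum>i\<in>I. poly p (u i) / (\<Prod>j\<in>I - {i}. u i - u j)) = coeff p (card I - 1)"
proof -
  have "coeff (\<Prod>j\<in>I - {i}. [:- u j, 1:]) (card I - 1) = 1" if "i \<in> I" for i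
  proof -
    have "degree (\<Prod>j\<in>I - {i}. [:- u j, 1:]) = card I - 1"
      using that assms(1) by (simp add: degree_prod_eq_sum_degree)
    moreover have "lead_coeff (\<Prod>j\<in>I - {i}. [:- u j, 1:]) = 1"
      unfolding lead_coeff_prod by simp
    ultimately show ?thesis by simp
  qed
  then show ?thesis
    by (subst (2) lagrange_interpolation[OF assms]) (simp add: coeff_sum)
qed

section \<open>The functional of the orthogonality\<close>

lemma falling_prod_Suc:
  "(\<Prod>i<Suc M. [:- real i, 1:]) = [:0, 1:] * shift_poly (- 1) (\<Prod>i<M. [:- real i, 1:])"
proof (rule poly_real_eqI)
  fix x
  show "poly (\<Prod>i<Suc M. [:- real i, 1:]) x = poly ([:0, 1:] * shift_poly (- 1) (\<Prod>i<M. [:- real i, 1:])) x"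
    unfolding poly_prod prod.lessThan_Suc_shift
    by (simp add: poly_prod poly_shift_poly algebra_simps)
qed

lemma charlier_measure_falling_prod:
  "charlier_measure a ((\<Prod>i<M. [:- real i, 1:]) * p) = a ^ M * charlier_measure a (shift_poly (real M) p)"
proof (induction M arbitrary: p)
  case (Suc M)
  let ?R = "\<Prod>i<M. [:- real i, 1:]"
  have "(\<Prod>i<Suc M. [:- real i, 1:]) * p = [:0, 1:] * shift_poly (- 1) (?R * shift_poly 1 p)"
    unfolding falling_prod_Suc by (simp add: mult.assoc)
  then have "charlier_measure a ((\<Prod>i<Suc M. [:- real i, 1:]) * p) = a * charlier_measure a (?R * shift_poly 1 p)"
    by (simp only: charlier_measure_shift)
  with Suc.IH[of "shift_poly 1 p"] show ?case by (simp add: add.commute)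
qed simp

lemma tilde_measure_linear:
  "tilde_measure a F (sum f A) = (\<Sum>i\<in>A. tilde_measure a F (f i))"
  "tilde_measure a F (p + q) = tilde_measure a F p + tilde_measure a F q"
  "tilde_measure a F (smult c p) = c * tilde_measure a F p"
  "tilde_measure a F 0 = 0"
  by (simp_all add: tilde_measure_def times_measure_def shift_measure_def sum_distrib_left distrib_left
      shift_poly_sum charlier_measure_sum charlier_measure_add charlier_measure_smult)

text \<open>
  The set \<open>F\<close> and the reflected numbers \<open>N - 1 - g\<close>, for
  \<open>g\<close> in the dual set \<open>G\<close>, partition \<open>{0, \<dots>, N - 1}\<close>; both the
  simplification of the measure and the formula for the order of the operator rest on this partition.
\<close>

locale charlier_dual_sets =
  fixes a :: real and F :: "nat set"
  assumes a: "a \<noteq> 0" and finF: "finite F" and neF: "F \<noteq> {}" and posF: "\<forall>f\<in>F. f > 0"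
begin

definition N where "N = Max F + 1"
definition G where "G = invol F"
definition m where "m = card G"

lemma G_eq: "G = {g. g < N \<and> Max F - g \<notin> F \<and> g > 0}"
proof -
  have "f \<le> Max F" if "f \<in> F" for f using that finF by simp
  then show ?thesis
    by (auto simp: G_def invol_def N_def)
qed

lemma G_lt: "g \<in> G \<Longrightarrow> g < N"
  by (simp add: G_eq)

lemma finG: "finite G"
  by (rule finite_subset[of _ "{..<N}"]) (auto simp: G_eq)

lemma complement: "F \<union> (\<lambda>g. N - 1 - g) ` G = {..<N}" "F \<inter> (\<lambda>g. N - 1 - g) ` G = {}"
  and inj_complement: "inj_on (\<lambda>g. N - 1 - g) G"
proof -
  have F: "f \<le> Max F" if "f \<in> F" for f using that finF by simp
  show "F \<union> (\<lambda>g. N - 1 - g) ` G = {..<N}"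
  proof (rule subset_antisym; rule subsetI)
    fix i assume "i \<in> F \<union> (\<lambda>g. N - 1 - g) ` G"
    then show "i \<in> {..<N}" using F by (auto simp: N_def less_Suc_eq_le)
  next
    fix i assume i: "i \<in> {..<N}"
    show "i \<in> F \<union> (\<lambda>g. N - 1 - g) ` G"
    proof (cases "i \<in> F")
      case False
      then have "i \<noteq> Max F" using finF neF Max_in by metis
      with i False have "Max F - i \<in> G" by (auto simp: G_eq N_def)
      moreover have "i = N - 1 - (Max F - i)" using i by (simp add: N_def)
      ultimately show ?thesis by blast
    qed simp
  qed
  show "F \<inter> (\<lambda>g. N - 1 - g) ` G = {}" by (auto simp: G_eq N_def)
  show "inj_on (\<lambda>g. N - 1 - g) G" using G_lt by (auto simp: inj_on_def dest!: G_lt)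
qed

lemma card_FG: "card F + m = N"
proof -
  have "card {..<N} = card F + card ((\<lambda>g. N - 1 - g) ` G)"
    unfolding complement(1)[symmetric] by (rule card_Un_disjoint) (use finF finG complement(2) in auto)
  then show ?thesis using card_image[OF inj_complement] by (simp add: m_def)
qed

lemma m_pos: "m \<ge> 1"
proof -
  have "Max F > 0" using finF neF posF Max_in by blast
  then have "Max F \<in> G" using posF by (auto simp: G_eq N_def)
  then show ?thesis using finG card_gt_0_iff[of G] by (auto simp: m_def)
qed

text \<open>
  The left-hand side is the degree of an antidifference of the Casoratian.  Summing \<open>i\<close> over the partition of
  \<open>{0, \<dots>, N - 1}\<close> expresses the sum over \<open>G\<close> by the sum over \<open>F\<close>; the subtraction of natural numbers does not
  truncate, because the sum of \<open>m\<close> distinct natural numbers is at least \<open>0 + \<dots> + (m - 1)\<close>.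
\<close>

lemma order_formula:
  "int (\<Sum>G - (\<Sum>i<m. i)) + 1 = (\<Sum>f\<in>F. int f) - int (card F) * (int (card F) - 1) div 2 + 1"
proof -
  have gauss: "2 * (\<Sum>i<n. int i) = int n * (int n - 1)" for n
    by (induction n) (auto simp: algebra_simps)
  have "(\<Sum>i<N. int i) = (\<Sum>f\<in>F. int f) + (\<Sum>i\<in>(\<lambda>g. N - 1 - g) ` G. int i)"
    unfolding complement(1)[symmetric]
    by (rule sum.union_disjoint) (use finF finG complement(2) in auto)
  also have "(\<Sum>i\<in>(\<lambda>g. N - 1 - g) ` G. int i) = (\<Sum>g\<in>G. int (N - 1 - g))"
    by (rule sum.reindex[OF inj_complement, unfolded o_def])
  also have "(\<Sum>g\<in>G. int (N - 1 - g)) = (\<Sum>g\<in>G. (int N - 1) - int g)"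
    using G_lt by (intro sum.cong) (auto simp: of_nat_diff Suc_le_eq)
  also have "\<dots> = int m * (int N - 1) - (\<Sum>g\<in>G. int g)"
    by (simp add: sum_subtractf m_def)
  finally have 1: "(\<Sum>i<N. int i) = (\<Sum>f\<in>F. int f) + int m * (int N - 1) - (\<Sum>g\<in>G. int g)" by simp
  have N: "int N = int (card F) + int m" using card_FG by simp
  have "2 * ((\<Sum>g\<in>G. int g) - (\<Sum>i<m. int i)) = 2 * (\<Sum>f\<in>F. int f) - int (card F) * (int (card F) - 1)"
    using 1 gauss[of N] gauss[of m] unfolding N by (simp add: algebra_simps)
  then have 2: "(\<Sum>g\<in>G. int g) - (\<Sum>i<m. int i) = (\<Sum>f\<in>F. int f) - int (card F) * (int (card F) - 1) div 2"
    by simp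
  have "(\<Sum>i<m. i) \<le> \<Sum>G"
  proof -
    have "\<Sum>{..<card A} \<le> \<Sum>A" if "finite A" for A :: "nat set"
      using that
    proof (induction "card A" arbitrary: A)
      case (Suc n)
      then have ne: "A \<noteq> {}" by auto
      define M where "M = Max A"
      have M: "M \<in> A" using Max_in[OF Suc.prems ne] by (simp add: M_def)
      have "A \<subseteq> {..M}" using Suc.prems by (auto simp: M_def)
      then have "card A \<le> Suc M" using card_mono[of "{..M}" A] by simp
      moreover have "\<Sum>{..<card (A - {M})} \<le> \<Sum>(A - {M})"
        using Suc M by (intro Suc.hyps) auto
      moreover have "card A = Suc (card (A - {M}))" using M Suc.prems by (metis card_Suc_Diff1)
      moreover have "\<Sum>A = M + \<Sum>(A - {M})" using M Suc.prems by (simp add: sum.remove)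
      ultimately show ?case by simp
    qed simp
    from this[OF finG] show ?thesis by (simp add: m_def)
  qed
  then show ?thesis using 2 by (simp add: of_nat_diff)
qed

definition node_poly where "node_poly = (\<Prod>g\<in>G. [:real g + 1, 1:])"
definition node_poly_omit where "node_poly_omit g = (\<Prod>g'\<in>G - {g}. [:real g' + 1, 1:])"

lemma tilde_eq: "tilde_measure a F p = charlier_measure a ((\<Prod>f\<in>F. [:- real f, 1:]) * shift_poly (- real N) p)"
proof -
  have N: "real (Max F) + 1 = real N" by (simp add: N_def)
  have "shift_poly (- real N) (\<Prod>f\<in>F. [:real N - real f, 1:]) = (\<Prod>f\<in>F. [:- real f, 1:])"
    by (rule poly_real_eqI) (simp add: poly_shift_poly poly_prod)
  then show ?thesis
    by (simp only: tilde_measure_def times_measure_def shift_measure_def N shift_poly_linear)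
qed

text \<open>
  After the shift by \<open>N\<close> the factor \<open>x + g + 1\<close> becomes \<open>x - (N - 1 - g)\<close>: multiplying with node factors fills
  the gaps of \<open>F\<close> in \<open>{0, \<dots>, N - 1}\<close>.
\<close>

lemma prod_complement:
  assumes "S \<subseteq> G"
  shows "(\<Prod>f\<in>F. [:- real f, 1:]) * shift_poly (- real N) (\<Prod>g\<in>S. [:real g + 1, 1:]) =
    (\<Prod>i\<in>F \<union> (\<lambda>g. N - 1 - g) ` S. [:- real i, 1:])"
proof -
  have "shift_poly (- real N) (\<Prod>g\<in>S. [:real g + 1, 1:]) = (\<Prod>g\<in>S. [:- real (N - 1 - g), 1:])"
  proof (rule poly_real_eqI)
    fix x
    have "real g + 1 + (x - real N) = x - real (N - 1 - g)" if "g \<in> S" for g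
      using G_lt[of g] that assms by (simp add: of_nat_diff subset_iff)
    then have "(\<Prod>g\<in>S. real g + 1 + (x - real N)) = (\<Prod>g\<in>S. x - real (N - 1 - g))"
      by (rule prod.cong[OF refl])
    then show "poly (shift_poly (- real N) (\<Prod>g\<in>S. [:real g + 1, 1:])) x = poly (\<Prod>g\<in>S. [:- real (N - 1 - g), 1:]) x"
      by (simp add: poly_shift_poly poly_prod)
  qed
  also have "\<dots> = (\<Prod>i\<in>(\<lambda>g. N - 1 - g) ` S. [:- real i, 1:])"
    by (rule prod.reindex[OF inj_on_subset[OF inj_complement assms], unfolded o_def, symmetric])
  finally have "shift_poly (- real N) (\<Prod>g\<in>S. [:real g + 1, 1:]) = \<dots>" .
  moreover have "F \<inter> (\<lambda>g. N - 1 - g) ` S = {}" "finite S"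
    using complement(2) assms finite_subset[OF assms finG] by blast+
  ultimately show ?thesis by (simp add: prod.union_disjoint finF)
qed

text \<open>
  With all gaps filled, the product is the falling factorial \<open>x (x - 1) \<dots> (x - N + 1)\<close>, which undoes the shift
  of the measure.  So the Charlier functional is the functional of the theorem times \<open>node_poly\<close>, up to a constant.
\<close>

lemma tilde_measure_node_poly: "tilde_measure a F (node_poly * p) = a ^ N * charlier_measure a p"
proof -
  have "(\<Prod>f\<in>F. [:- real f, 1:]) * shift_poly (- real N) node_poly = (\<Prod>i<N. [:- real i, 1:])"
    unfolding node_poly_def prod_complement[OF order.refl] complement(1) ..
  then have "tilde_measure a F (node_poly * p) = charlier_measure a ((\<Prod>i<N. [:- real i, 1:]) * shift_poly (- real N) p)"
    by (simp add: tilde_eq mult.assoc[symmetric])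
  then show ?thesis by (simp add: charlier_measure_falling_prod)
qed

text \<open>
  One gap \<open>M = N - 1 - g\<close> remains.  The factors below \<open>M\<close> form a falling factorial and shift the measure by
  \<open>M\<close>; the \<open>g\<close> factors above it become \<open>(x - 1) \<dots> (x - g) = g! binom(x - 1, g)\<close>.
\<close>

lemma tilde_measure_node_poly_omit:
  assumes g: "g \<in> G"
  shows "tilde_measure a F (node_poly_omit g * p) =
    a ^ (N - 1 - g) * fact g * charlier_measure a (shift_poly (- 1) (binom_poly g) * shift_poly (- real g - 1) p)"
proof -
  define M where "M = N - 1 - g"
  have N: "N = M + Suc g" and M: "M < N"
    using G_lt[OF g] by (auto simp: M_def)
  have shift: "real M + - real N = - real g - 1" by (simp add: N)
  have "F \<union> (\<lambda>g. N - 1 - g) ` (G - {g}) = {..<N} - {M}"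
  proof -
    have "(\<lambda>g. N - 1 - g) ` (G - {g}) = (\<lambda>g. N - 1 - g) ` G - {M}"
      using inj_on_image_set_diff[OF inj_complement, of G "{g}"] g by (simp add: M_def)
    moreover have "M \<notin> F" using complement(2) g by (auto simp: M_def)
    ultimately show ?thesis using complement(1) by blast
  qed
  also have "\<dots> = {..<M} \<union> {Suc M..<N}" using M by auto
  finally have FM: "F \<union> (\<lambda>g. N - 1 - g) ` (G - {g}) = {..<M} \<union> {Suc M..<N}" .
  have "(\<Prod>f\<in>F. [:- real f, 1:]) * shift_poly (- real N) (node_poly_omit g) =
      (\<Prod>i<M. [:- real i, 1:]) * (\<Prod>i=Suc M..<N. [:- real i, 1:])"
    unfolding node_poly_omit_def prod_complement[OF Diff_subset] FM by (rule prod.union_disjoint) auto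
  then have "tilde_measure a F (node_poly_omit g * p) = charlier_measure a
      ((\<Prod>i<M. [:- real i, 1:]) * ((\<Prod>i=Suc M..<N. [:- real i, 1:]) * shift_poly (- real N) p))"
    by (simp add: tilde_eq mult.assoc[symmetric])
  also have "\<dots> = a ^ M * charlier_measure a
      (shift_poly (real M) (\<Prod>i=Suc M..<N. [:- real i, 1:]) * shift_poly (- real g - 1) p)"
    by (simp only: charlier_measure_falling_prod shift_poly_linear shift_poly_shift_poly shift)
  also have "shift_poly (real M) (\<Prod>i=Suc M..<N. [:- real i, 1:]) = smult (fact g) (shift_poly (- 1) (binom_poly g))"
  proof (rule poly_real_eqI)
    fix x
    have "(\<Prod>i=Suc M..<N. x + real M - real i) = (\<Prod>i<g. x - 1 - real i)"
      by (rule prod.reindex_bij_witness[of _ "\<lambda>i. i + Suc M" "\<lambda>i. i - Suc M"])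
        (auto simp: N of_nat_diff)
    then show "poly (shift_poly (real M) (\<Prod>i=Suc M..<N. [:- real i, 1:])) x =
        poly (smult (fact g) (shift_poly (- 1) (binom_poly g))) x"
      by (simp add: poly_shift_poly poly_prod binom_poly_def algebra_simps)
  qed
  finally show ?thesis by (simp add: charlier_measure_smult M_def)
qed

text \<open>
  The Lagrange coefficient of \<open>p\<close> at the node \<open>- g - 1\<close>, times the constant that comes with the functional
  with the node \<open>- g - 1\<close> left out.
\<close>

definition interp_weight :: "real poly \<Rightarrow> nat \<Rightarrow> real" where
  "interp_weight p g = poly p (- real g - 1) / (\<Prod>g'\<in>G - {g}. real g' - real g) * (exp a * a ^ (N - 1 - g) * fact g)"

lemma inj_nodes: "inj_on (\<lambda>g. - real g - 1) G"
  by (auto simp: inj_on_def)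

lemma lagrange_G:
  assumes "degree p < m"
  shows "p = (\<Sum>g\<in>G. smult (poly p (- real g - 1) / (\<Prod>g'\<in>G - {g}. real g' - real g)) (node_poly_omit g))"
proof -
  have "- (- real g - 1) = real g + 1" "- real g - 1 - (- real g' - 1) = real g' - real g" for g g'
    by simp_all
  then show ?thesis
    using lagrange_interpolation[OF finG inj_nodes, of p] assms by (simp only: m_def node_poly_omit_def)
qed

lemma degree_node_poly: "degree node_poly = m"
  unfolding node_poly_def by (simp add: degree_prod_eq_sum_degree m_def)

lemma node_poly_root: "g \<in> G \<Longrightarrow> poly node_poly (- real g - 1) = 0"
  unfolding node_poly_def poly_prod by (rule prod_zero[OF finG]) force

text \<open>
  Division by \<open>node_poly\<close>: the multiple of \<open>node_poly\<close> is integrated against the Charlier functional, and the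
  remainder is replaced by its Lagrange interpolation, whose terms have known moments.
\<close>

lemma tilde_charlier_split:
  assumes p: "p = node_poly * p1 + p2" and "degree p2 < m"
  shows "tilde_measure a F (p * charlier a (int i)) = a ^ N * charlier_measure a (charlier a (int i) * p1) +
    (- 1) ^ i * (\<Sum>g\<in>G. interp_weight p g * poly (charlier (- a) (int g)) (- real i - 1))"
proof -
  let ?c = "charlier a (int i)" and ?e = "\<lambda>g. poly p (- real g - 1) / (\<Prod>g'\<in>G - {g}. real g' - real g)"
  have "p2 = (\<Sum>g\<in>G. smult (?e g) (node_poly_omit g))"
  proof -
    have "poly p2 (- real g - 1) = poly p (- real g - 1)" if "g \<in> G" for g
      using node_poly_root[OF that] by (simp add: p)
    then show ?thesis using lagrange_G[OF assms(2)] by simp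
  qed
  from arg_cong[OF this, of "\<lambda>q. q * ?c"]
  have "p2 * ?c = (\<Sum>g\<in>G. smult (?e g) (node_poly_omit g * ?c))"
    by (simp only: sum_distrib_right mult_smult_left)
  moreover have "p * ?c = node_poly * (p1 * ?c) + p2 * ?c"
    by (simp add: p algebra_simps)
  ultimately have "p * ?c = node_poly * (p1 * ?c) + (\<Sum>g\<in>G. smult (?e g) (node_poly_omit g * ?c))"
    by (simp only:)
  then have "tilde_measure a F (p * ?c) = tilde_measure a F (node_poly * (p1 * ?c)) +
      (\<Sum>g\<in>G. ?e g * tilde_measure a F (node_poly_omit g * ?c))"
    by (simp only: tilde_measure_linear)
  also have "(\<Sum>g\<in>G. ?e g * tilde_measure a F (node_poly_omit g * ?c)) =
      (- 1) ^ i * (\<Sum>g\<in>G. interp_weight p g * poly (charlier (- a) (int g)) (- real i - 1))"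
    unfolding sum_distrib_left
    by (intro sum.cong refl) (simp add: tilde_measure_node_poly_omit charlier_measure_dual interp_weight_def)
  finally show ?thesis by (simp add: tilde_measure_node_poly mult.commute)
qed

text \<open>
  For small degrees the quotient by \<open>node_poly\<close> has degree less than \<open>i\<close> and is orthogonal to \<open>c\<^sub>i\<close>.  At the
  first degree where this fails, the pairing does not vanish.
\<close>

lemma tilde_charlier_defect:
  defines "defect p i \<equiv> tilde_measure a F (p * charlier a (int i)) -
    (- 1) ^ i * (\<Sum>g\<in>G. interp_weight p g * poly (charlier (- a) (int g)) (- real i - 1))"
  shows "degree p < m + i \<Longrightarrow> defect p i = 0"
    and "\<lbrakk>p \<noteq> 0; degree p = m + i\<rbrakk> \<Longrightarrow> defect p i \<noteq> 0"
proof -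
  let ?p1 = "p div node_poly" and ?p2 = "p mod node_poly"
  have "node_poly \<noteq> 0" using degree_node_poly m_pos by auto
  then have p2: "degree ?p2 < m"
    using degree_mod_less[of node_poly p] degree_node_poly m_pos by auto
  have p: "p = node_poly * ?p1 + ?p2" by simp
  have defect: "defect p i = a ^ N * charlier_measure a (charlier a (int i) * ?p1)"
    unfolding defect_def tilde_charlier_split[OF p p2] by simp
  have deg: "degree p = m + degree ?p1" if "?p1 \<noteq> 0"
  proof -
    have "degree (node_poly * ?p1) = m + degree ?p1"
      using that \<open>node_poly \<noteq> 0\<close> by (simp add: degree_mult_eq degree_node_poly)
    with p2 show ?thesis using degree_add_eq_left[of ?p2 "node_poly * ?p1"] p by simp
  qed
  show "defect p i = 0" if "degree p < m + i"
  proof (cases "?p1 = 0")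
    case False
    with deg that have "degree ?p1 < i" by simp
    then show ?thesis unfolding defect by (simp add: charlier_measure_orthogonal)
  qed (simp add: defect)
  show "defect p i \<noteq> 0" if "p \<noteq> 0" "degree p = m + i"
  proof -
    have "?p1 \<noteq> 0"
    proof
      assume "?p1 = 0"
      then have "p = ?p2" using p by simp
      then have "degree p < m" using p2 by metis
      with that show False by simp
    qed
    then show ?thesis
      unfolding defect using charlier_measure_nonorthogonal[OF a, of ?p1 i] deg that a by simp
  qed
qed

text \<open>
  By duality the values \<open>c\<^sub>g(t)\<close> are, up to the factor \<open>a\<^bsup>g\<^esup> / g!\<close> contained in the weights, the values of a
  polynomial of degree \<open>t\<close> at the nodes, so the sum is a divided difference.
\<close>

lemma interp_weight_sum:
  assumes "degree p + t < m"
  shows "(\<Sum>g\<in>G. interp_weight p g * poly (charlier (- a) (int g)) (real t)) =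
    exp a * a ^ (N - 1) * fact t / a ^ t *
      coeff (p * pcompose (charlier (- a) (int t)) [:- 1, - 1:]) (m - 1)"
proof -
  define R where "R = p * pcompose (charlier (- a) (int t)) [:- 1, - 1:]"
  define K where "K = exp a * a ^ (N - 1) * fact t / a ^ t"
  have "interp_weight p g * poly (charlier (- a) (int g)) (real t) =
      K * (poly R (- real g - 1) / (\<Prod>g'\<in>G - {g}. real g' - real g))" if g: "g \<in> G" for g
  proof -
    have "a ^ (N - 1 - g) = a ^ (N - 1) / a ^ g"
      using G_lt[OF g] a by (intro power_diff) auto
    then have "a ^ (N - 1 - g) * fact g * poly (charlier (- a) (int g)) (real t) =
        a ^ (N - 1) * (fact g * poly (charlier (- a) (int g)) (real t) / a ^ g)" by simp
    also have "\<dots> = a ^ (N - 1) * (fact t * poly (charlier (- a) (int t)) (real g) / a ^ t)"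
      by (simp only: charlier_duality[OF a])
    finally have "exp a * (a ^ (N - 1 - g) * fact g * poly (charlier (- a) (int g)) (real t)) =
        K * poly (charlier (- a) (int t)) (real g)" by (simp add: K_def)
    moreover have "poly R (- real g - 1) = poly p (- real g - 1) * poly (charlier (- a) (int t)) (real g)"
      by (simp add: R_def poly_pcompose)
    ultimately show ?thesis by (simp add: interp_weight_def mult_ac)
  qed
  then have "(\<Sum>g\<in>G. interp_weight p g * poly (charlier (- a) (int g)) (real t)) =
      K * (\<Sum>g\<in>G. poly R (- real g - 1) / (\<Prod>g'\<in>G - {g}. real g' - real g))"
    by (simp add: sum_distrib_left)
  also have "(\<Sum>g\<in>G. poly R (- real g - 1) / (\<Prod>g'\<in>G - {g}. real g' - real g)) = coeff R (m - 1)"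
  proof -
    have "degree R \<le> degree p + t"
      unfolding R_def by (rule order.trans[OF degree_mult_le]) (simp add: degree_pcompose)
    then have "degree R < card G" using assms by (simp add: m_def)
    moreover have "- real g - 1 - (- real g' - 1) = real g' - real g" for g g' by simp
    ultimately show ?thesis using divided_difference[OF finG inj_nodes, of R] by (simp only: m_def)
  qed
  finally show ?thesis by (simp add: K_def R_def)
qed

text \<open>
  The same statement as in the previous lemmas with the index \<open>n - j\<close>, which can be negative.  In that case
  the Charlier polynomial is 0, and the sum over \<open>G\<close> is a divided difference of order \<open>m - 1\<close> of a polynomial of
  degree \<open>degree p + (j - n - 1)\<close>, which is 0 if this degree is less than \<open>m - 1\<close>.  The exceptional term \<open>d\<close> occurs only for \<open>j = m\<close>
  and \<open>degree p = n\<close>.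
\<close>

lemma tilde_charlier_general:
  assumes j: "j \<le> m" and p: "degree p \<le> n"
  shows "\<exists>d. tilde_measure a F (p * charlier a (int n - int j)) =
      (- 1) ^ (n + j) * (\<Sum>g\<in>G. interp_weight p g * poly (charlier (- a) (int g)) (- (real n - real j) - 1)) + d \<and>
    (j < m \<or> degree p < n \<longrightarrow> d = 0) \<and> (j = m \<and> degree p = n \<and> p \<noteq> 0 \<longrightarrow> d \<noteq> 0)"
proof (cases "j \<le> n")
  case True
  then obtain i where n: "n = i + j" by (metis add.commute le_Suc_ex)
  have sgn: "(- 1) ^ (n + j) = ((- 1) ^ i :: real)" by (simp add: n power_add flip: power_mult_distrib)
  have arg: "int n - int j = int i" "real n - real j = real i" by (simp_all add: n)
  show ?thesis
    unfolding sgn arg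
    by (rule exI[of _ "tilde_measure a F (p * charlier a (int i)) -
        (- 1) ^ i * (\<Sum>g\<in>G. interp_weight p g * poly (charlier (- a) (int g)) (- real i - 1))"])
      (use tilde_charlier_defect[of p i] j p n in auto)
next
  case False
  define t where "t = j - n - 1"
  have t: "j = n + t + 1" using False by (simp add: t_def)
  let ?S = "\<Sum>g\<in>G. interp_weight p g * poly (charlier (- a) (int g)) (real t)"
  have arg: "- (real n - real j) - 1 = real t" by (simp add: t)
  have zero: "tilde_measure a F (p * charlier a (int n - int j)) = 0"
    using False by (simp add: tilde_measure_linear)
  define R where "R = pcompose (charlier (- a) (int t)) [:- 1, - 1:]"
  have R: "degree R = t" "R \<noteq> 0"
  proof -
    show "degree R = t" by (simp add: R_def degree_pcompose)
    have "charlier (- a) (int t) \<noteq> 0" using coeff_charlier[of "- a" t] by (metis coeff_0 divide_eq_0_iff fact_nonzero zero_neq_one)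
    then show "R \<noteq> 0" by (auto simp: R_def pcompose_eq_0_iff)
  qed
  have S: "?S = exp a * a ^ (N - 1) * fact t / a ^ t * coeff (p * R) (m - 1)"
    unfolding R_def by (rule interp_weight_sum) (use j p t in auto)
  have "?S = 0" if "j < m \<or> degree p < n"
  proof -
    have "degree (p * R) < m - 1"
      using degree_mult_le[of p R] R that j p t by linarith
    then show ?thesis unfolding S by (simp add: coeff_eq_0)
  qed
  moreover have "?S \<noteq> 0" if "j = m \<and> degree p = n \<and> p \<noteq> 0"
  proof -
    have "degree (p * R) = m - 1" "p * R \<noteq> 0"
      using R that t by (auto simp: degree_mult_eq)
    then have "coeff (p * R) (m - 1) \<noteq> 0" by (metis leading_coeff_0_iff)
    then show ?thesis unfolding S using a by simp
  qed
  ultimately show ?thesis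
    unfolding zero arg by (intro exI[of _ "- ((- 1) ^ (n + j) * ?S)"]) auto
qed

text \<open>
  The cofactors in \<open>q\<^sub>n\<close> annihilate the sums over \<open>G\<close>, which leaves \<open>d\<close> for \<open>j = m\<close>, times the last cofactor
  \<open>\<plusminus> \<Omega>\<^sub>G(n + 1)\<close>.
\<close>

lemma tilde_q_poly:
  assumes p: "degree p \<le> n" and \<Omega>: "Omega a G (Suc n) \<noteq> 0"
  shows "degree p < n \<Longrightarrow> tilde_measure a F (p * q_poly a G n) = 0"
    and "\<lbrakk>degree p = n; p \<noteq> 0\<rbrakk> \<Longrightarrow> tilde_measure a F (p * q_poly a G n) \<noteq> 0"
proof -
  define b where "b j = poly (border_cof (dual_charlier a G) m j) (real n)" for j
  define k where "k j g = poly (charlier (- a) (int g)) (- (real n - real j) - 1)" for j g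
  have "\<forall>j\<in>{..m}. \<exists>d. tilde_measure a F (p * charlier a (int n - int j)) =
      (- 1) ^ (n + j) * (\<Sum>g\<in>G. interp_weight p g * k j g) + d \<and>
    (j < m \<or> degree p < n \<longrightarrow> d = 0) \<and> (j = m \<and> degree p = n \<and> p \<noteq> 0 \<longrightarrow> d \<noteq> 0)"
    unfolding k_def using tilde_charlier_general[OF _ p] by blast
  from bchoice[OF this] obtain d where D: "\<forall>j\<in>{..m}. tilde_measure a F (p * charlier a (int n - int j)) =
      (- 1) ^ (n + j) * (\<Sum>g\<in>G. interp_weight p g * k j g) + d j \<and>
    (j < m \<or> degree p < n \<longrightarrow> d j = 0) \<and> (j = m \<and> degree p = n \<and> p \<noteq> 0 \<longrightarrow> d j \<noteq> 0)" ..
  have d: "j \<le> m \<Longrightarrow> tilde_measure a F (p * charlier a (int n - int j)) =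
      (- 1) ^ (n + j) * (\<Sum>g\<in>G. interp_weight p g * k j g) + d j"
    "j \<le> m \<Longrightarrow> j < m \<or> degree p < n \<Longrightarrow> d j = 0"
    "degree p = n \<Longrightarrow> p \<noteq> 0 \<Longrightarrow> d m \<noteq> 0" for j
    using bspec[OF D, of j] bspec[OF D, of m] by simp_all
  have ann: "(\<Sum>j\<le>m. b j * k j g) = 0" if "g \<in> G" for g
  proof -
    have "g \<in> set (sorted_list_of_set G)" using that finG by simp
    then obtain l where "l < length (sorted_list_of_set G)" "sorted_list_of_set G ! l = g"
      unfolding in_set_conv_nth by blast
    then have "l < m" "sorted_list_of_set G ! l = g" by (simp_all add: m_def)
    then show ?thesis
      using border_cof_annihilates[of l m "dual_charlier a G" "real n"]
      by (simp add: b_def k_def poly_dual_charlier)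
  qed
  have "tilde_measure a F (p * q_poly a G n) =
      (\<Sum>j\<le>m. ((- 1) ^ j * b j) * tilde_measure a F (p * charlier a (int n - int j)))"
    unfolding q_poly_eq_bordered_charlier bordered_charlier_def
    by (simp add: sum_distrib_left tilde_measure_linear m_def b_def)
  also have "\<dots> = (\<Sum>j\<le>m. (- 1) ^ n * (\<Sum>g\<in>G. interp_weight p g * (b j * k j g)) + (- 1) ^ j * b j * d j)"
  proof (rule sum.cong)
    fix j assume "j \<in> {..m}"
    then have j: "j \<le> m" by simp
    have sgn: "(- 1) ^ j * (- 1) ^ (n + j) = ((- 1) ^ n :: real)"
      by (simp add: power_add mult.left_commute flip: power_mult_distrib)
    have "((- 1) ^ j * b j) * tilde_measure a F (p * charlier a (int n - int j)) =
        ((- 1) ^ j * (- 1) ^ (n + j)) * (b j * (\<Sum>g\<in>G. interp_weight p g * k j g)) + (- 1) ^ j * b j * d j"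
      unfolding d(1)[OF j] by (simp only: algebra_simps)
    also have "b j * (\<Sum>g\<in>G. interp_weight p g * k j g) = (\<Sum>g\<in>G. interp_weight p g * (b j * k j g))"
      unfolding sum_distrib_left by (simp only: mult_ac)
    finally show "((- 1) ^ j * b j) * tilde_measure a F (p * charlier a (int n - int j)) =
        (- 1) ^ n * (\<Sum>g\<in>G. interp_weight p g * (b j * k j g)) + (- 1) ^ j * b j * d j"
      unfolding sgn .
  qed simp
  also have "\<dots> = (- 1) ^ n * (\<Sum>g\<in>G. interp_weight p g * (\<Sum>j\<le>m. b j * k j g)) + (\<Sum>j\<le>m. (- 1) ^ j * b j * d j)"
    unfolding sum.distrib sum_distrib_left by (subst sum.swap) simp
  also have "\<dots> = (\<Sum>j\<le>m. (- 1) ^ j * b j * d j)" using ann by simp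
  also have "\<dots> = (\<Sum>j\<in>{m}. (- 1) ^ j * b j * d j)"
    by (rule sum.mono_neutral_right) (use d(2) in auto)
  finally have T: "tilde_measure a F (p * q_poly a G n) = (- 1) ^ m * b m * d m" by simp
  have "b m = (- 1) ^ m * Omega a G (Suc n)"
    by (simp add: b_def border_cof_last Omega_eq_casoratian poly_shift_poly m_def add.commute)
  with \<Omega> have "b m \<noteq> 0" by simp
  then show "degree p = n \<Longrightarrow> p \<noteq> 0 \<Longrightarrow> tilde_measure a F (p * q_poly a G n) \<noteq> 0"
    using T d(3) by simp
  show "degree p < n \<Longrightarrow> tilde_measure a F (p * q_poly a G n) = 0"
    using T d(2)[of m] by simp
qed

end

lemma diff_operator_eq_dop:
  assumes "spans h (- r) r"
  shows "diff_operator (- r) r h p = dop h p"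
  unfolding diff_operator_def
  by (rule dop_superset[symmetric]) (use assms in \<open>auto simp: spans_def\<close>)

theorem theorem1p1:
  fixes a :: real and F :: "nat set"
  assumes "a \<noteq> 0"
    and "finite F" and "F \<noteq> {}" and "\<forall>f\<in>F. f > 0"
    and "\<forall>n. Omega a (invol F) n \<noteq> 0"
  shows "orthogonal_polys (tilde_measure a F) (q_poly a (invol F)) \<and>
    (let r = (\<Sum>f\<in>F. int f) - int (card F) * (int (card F) - 1) div 2 + 1 in
       \<exists>h :: int \<Rightarrow> real poly. h (- r) \<noteq> 0 \<and> h r \<noteq> 0 \<and>
         (\<forall>n. \<exists>c::real. diff_operator (- r) r h (q_poly a (invol F) n)
                         = smult c (q_poly a (invol F) n)))"
proof -
  interpret charlier_dual_sets a F by unfold_locales (use assms in auto)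
  define y where "y = dual_charlier a G"
  have q: "q_poly a G n = bordered_charlier a y m (int n)" for n
    unfolding y_def m_def by (rule q_poly_eq_bordered_charlier)
  have \<Omega>: "Omega a G n \<noteq> 0" for n using assms(5) by (simp add: G_def)
  then have cas: "poly (casoratian y m) (real n) \<noteq> 0" for n
    by (simp add: Omega_eq_casoratian y_def m_def)
  have deg: "degree (q_poly a G n) = n" and nz: "q_poly a G n \<noteq> 0" for n
    unfolding q by (rule bordered_charlier_degree[OF cas])+
  have "orthogonal_polys (tilde_measure a F) (q_poly a G)"
    unfolding orthogonal_polys_def
  proof (intro conjI allI impI)
    fix n k :: nat assume "n \<noteq> k"
    have *: "tilde_measure a F (q_poly a G i * q_poly a G j) = 0" if "i < j" for i j
      using tilde_q_poly(1)[of "q_poly a G i" j] that \<Omega> deg by simp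
    show "tilde_measure a F (q_poly a G n * q_poly a G k) = 0"
      using *[of n k] *[of k n] \<open>n \<noteq> k\<close> by (cases "n < k") (auto simp: mult.commute)
  next
    fix n
    show "tilde_measure a F (q_poly a G n ^ 2) \<noteq> 0"
      using tilde_q_poly(2)[of "q_poly a G n" n] \<Omega> deg nz by (simp add: power2_eq_square)
  qed (rule deg)
  moreover have "\<exists>h. h (- r) \<noteq> 0 \<and> h r \<noteq> 0 \<and>
      (\<forall>n. \<exists>c. diff_operator (- r) r h (q_poly a G n) = smult c (q_poly a G n))"
    if r: "r = (\<Sum>f\<in>F. int f) - int (card F) * (int (card F) - 1) div 2 + 1" for r
  proof -
    note cas_deg = degree_casoratian_dual_charlier[OF finG, of a, folded m_def y_def]
    obtain Q where Q: "forward_diff Q = casoratian y m" "degree Q = Suc (degree (casoratian y m))"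
      using forward_diff_antiderivative[OF cas_deg(1)] by blast
    define P where "P = shift_poly 1 Q"
    have P: "poly P x - poly P (x - 1) = poly (casoratian y m) x" for x
      unfolding Q(1)[symmetric] P_def forward_diff_def by (simp add: poly_shift_poly)
    have degP: "int (degree P) = r"
      unfolding r order_formula[symmetric] P_def degree_shift_poly Q(2) cas_deg(2) by simp
    have "P \<noteq> 0" using Q(2) by (auto simp: P_def)
    then have "spans (eigen_op a y m P) (- r) r"
      unfolding degP[symmetric] using P nz q by (intro spans_eigen_op[OF a]) auto
    then show ?thesis
      using eigen_op_bordered_charlier[OF P, of a] unfolding q
      by (intro exI[of _ "eigen_op a y m P"]) (auto simp: diff_operator_eq_dop, auto simp: spans_def)
  qed
  ultimately show ?thesis by (simp add: G_def Let_def)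
qed

end
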